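(* Let $(G,u)\in\mathbf{W}^*$, i.e. $G$ is an Archimedean $\ell$-group and $u\geq 0$ is a strong unit of $G$, regarded as $G\le C(YG)$ via the Yosida representation. The following are equivalent: (1) $G\in(\mathrm{CR})$ (equivalently, any/all of these hold: for all $f,g\in G$, $\mathrm{coz}(f)\subseteq\overline{\mathrm{coz}(g)}$ implies $\mathrm{coz}(f)\subseteq\mathrm{coz}(g)$; for all $g\in G$, $I(Z(g))=I(\mathrm{cl}\,\mathrm{int}\,Z(g))$, i.e. $Z(g)=\mathrm{cl}\,\mathrm{int}\,Z(g)$; for all $g\in G$, $I(Z(g))=g^{\perp\perp}$). (2) For each $g\in G$, $I(Z(g))$ is a $d$-ideal (equivalently, any/all of these hold: each $\mathbf{W}^*$-kernel of $G$ is a $d$-ideal; for all $p\in YG$, $M_p=\{g\in G: g(p)=0\}$ is a $d$-ideal). (3) In $G$, each weak unit is a strong unit.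
   Context: An ideal of an abelian $\ell$-group $G$ is a convex sub-$\ell$-group. For $g\in G$: $G(g)=\{f\in G : |f|\le n|g| \text{ for some positive integer } n\}$; $g^\perp=\{f\in G: |f|\wedge|g|=0\}$; for $S\subseteq G$, $S^\perp=\bigcap_{s\in S}s^\perp$; and $g^{\perp\perp}=(g^\perp)^\perp$. A weak unit is an element $v\ge0$ with $v^\perp=\{0\}$; a strong unit is an element $v\ge 0$ with $G(v)=G$. An ideal $I$ is a $d$-ideal if $g\in I$ implies $g^{\perp\perp}\subseteq I$. $(G,u)\in\mathbf{W}^*$ means $G$ is Archimedean and $u$ is a strong unit. A $\mathbf{W}^*$-morphism $(G,u)\to(H,v)$ is an $\ell$-group homomorphism taking $u$ to $v$; a $\mathbf{W}^*$-kernel of $G$ is the kernel of a $\mathbf{W}^*$-morphism from $(G,u)$ to some object of $\mathbf{W}^*$. $YG=Y(G,u)$ is the set of ideals of $G$ maximal with respect to not containing $u$ (these are the proper maximal ideals), with the hull-kernel topology; it is compact Hausdorff. For $M\in YG$ there is a unique embedding $G/M\to\mathbb{R}$ of $\ell$-groups taking $u+M$ to $1$, and $g(M)$ denotes the image of $g+M$; this gives the (Yosida) embedding $G\le C(YG)$ with $u\mapsto 1$, whose image $0$-$1$ separates disjoint closed sets of $YG$. Then $\mathrm{coz}(g)=\{x\in YG: g(x)\ne0\}$, $Z(g)=YG\setminus\mathrm{coz}(g)$, and for closed $S\subseteq YG$, $I(S)=\{g\in G: Z(g)\supseteq S\}$. Closures and interiors are taken in $YG$. $G\in(\mathrm{CR})$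 means: for all $g\in G$, $\mathrm{coz}(g)$ is regular open in $YG$, i.e. equals the interior of its closure. *)

theory Defs
  imports "HOL-Algebra.Coset" "HOL-Algebra.Lattice" "HOL-Analysis.Abstract_Topology"
begin

text \<open>
  Abelian \<open>\<ell>\<close>-groups are carrier-based structures over the groups and lattices of HOL-Algebra.
  The group operation is therefore written multiplicatively: \<open>\<one>\<close> is the zero element \<open>0\<close>,
  \<open>inv x\<close> is \<open>- x\<close>, and \<open>x [^] n\<close> is the multiple \<open>n x\<close>.
\<close>

record 'a lgroup = "'a monoid" +
  lle :: "'a \<Rightarrow> 'a \<Rightarrow> bool"

definition lorder :: "'a lgroup \<Rightarrow> 'a gorder" where
  "lorder G = \<lparr>carrier = carrier G, eq = (=), le = lle G\<rparr>"

definition lsup :: "'a lgroup \<Rightarrow> 'a \<Rightarrow> 'a \<Rightarrow> 'a" where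
  "lsup G x y = x \<squnion>\<^bsub>lorder G\<^esub> y"

definition linf :: "'a lgroup \<Rightarrow> 'a \<Rightarrow> 'a \<Rightarrow> 'a" where
  "linf G x y = x \<sqinter>\<^bsub>lorder G\<^esub> y"

definition labs :: "'a lgroup \<Rightarrow> 'a \<Rightarrow> 'a" where
  "labs G x = lsup G x (inv\<^bsub>G\<^esub> x)"

definition abelian_lgroup :: "'a lgroup \<Rightarrow> bool" where
  "abelian_lgroup G \<longleftrightarrow> comm_group G \<and> lattice (lorder G) \<and>
     (\<forall>x\<in>carrier G. \<forall>y\<in>carrier G. \<forall>z\<in>carrier G.
        lle G x y \<longrightarrow> lle G (x \<otimes>\<^bsub>G\<^esub> z) (y \<otimes>\<^bsub>G\<^esub> z))"

definition archimedean :: "'a lgroup \<Rightarrow> bool" where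
  "archimedean G \<longleftrightarrow> (\<forall>a\<in>carrier G. \<forall>b\<in>carrier G.
     lle G \<one>\<^bsub>G\<^esub> a \<and> (\<forall>n::nat. lle G (a [^]\<^bsub>G\<^esub> n) b) \<longrightarrow> a = \<one>\<^bsub>G\<^esub>)"

definition lideal :: "'a lgroup \<Rightarrow> 'a set \<Rightarrow> bool" where
  "lideal G I \<longleftrightarrow> subgroup I G \<and>
     (\<forall>x\<in>I. \<forall>y\<in>I. lsup G x y \<in> I \<and> linf G x y \<in> I) \<and>
     (\<forall>x\<in>I. \<forall>y\<in>I. \<forall>z\<in>carrier G. lle G x z \<and> lle G z y \<longrightarrow> z \<in> I)"

definition principal_lideal :: "'a lgroup \<Rightarrow> 'a \<Rightarrow> 'a set" where
  "principal_lideal G g =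
     {f \<in> carrier G. \<exists>n::nat. 0 < n \<and> lle G (labs G f) (labs G g [^]\<^bsub>G\<^esub> n)}"

definition polar :: "'a lgroup \<Rightarrow> 'a \<Rightarrow> 'a set" where
  "polar G g = {f \<in> carrier G. linf G (labs G f) (labs G g) = \<one>\<^bsub>G\<^esub>}"

definition polar_set :: "'a lgroup \<Rightarrow> 'a set \<Rightarrow> 'a set" where
  "polar_set G S = {f \<in> carrier G. \<forall>s\<in>S. f \<in> polar G s}"

definition bipolar :: "'a lgroup \<Rightarrow> 'a \<Rightarrow> 'a set" where
  "bipolar G g = polar_set G (polar G g)"

definition weak_unit :: "'a lgroup \<Rightarrow> 'a \<Rightarrow> bool" where
  "weak_unit G v \<longleftrightarrow> v \<in> carrier G \<and> lle G \<one>\<^bsub>G\<^esub> v \<and> polar G v = {\<one>\<^bsub>G\<^esub>}"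

definition strong_unit :: "'a lgroup \<Rightarrow> 'a \<Rightarrow> bool" where
  "strong_unit G v \<longleftrightarrow> v \<in> carrier G \<and> lle G \<one>\<^bsub>G\<^esub> v \<and> principal_lideal G v = carrier G"

definition d_ideal :: "'a lgroup \<Rightarrow> 'a set \<Rightarrow> bool" where
  "d_ideal G I \<longleftrightarrow> lideal G I \<and> (\<forall>g\<in>I. bipolar G g \<subseteq> I)"

definition Wstar :: "'a lgroup \<Rightarrow> 'a \<Rightarrow> bool" where
  "Wstar G u \<longleftrightarrow> abelian_lgroup G \<and> archimedean G \<and> strong_unit G u"

definition lgroup_hom :: "'a lgroup \<Rightarrow> 'b lgroup \<Rightarrow> ('a \<Rightarrow> 'b) set" where
  "lgroup_hom G H = {h \<in> hom G H. \<forall>x\<in>carrier G. \<forall>y\<in>carrier G.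
     h (lsup G x y) = lsup H (h x) (h y) \<and> h (linf G x y) = linf H (h x) (h y)}"

definition Wstar_morphism :: "'a lgroup \<Rightarrow> 'a \<Rightarrow> 'b lgroup \<Rightarrow> 'b \<Rightarrow> ('a \<Rightarrow> 'b) \<Rightarrow> bool" where
  "Wstar_morphism G u H v h \<longleftrightarrow> h \<in> lgroup_hom G H \<and> h u = v"

text \<open>
  HOL cannot quantify over the type of the target object, so the targets range over the objects
  of \<open>W\<^sup>*\<close> whose elements are sets of elements of the given type. Lemma \<open>Wstar_kernelI\<close>
  at the end shows that kernels of morphisms into objects over any other type are covered.
\<close>

definition Wstar_kernel :: "'a lgroup \<Rightarrow> 'a \<Rightarrow> 'a set \<Rightarrow> bool" where
  "Wstar_kernel G u K \<longleftrightarrow> (\<exists>(H :: 'a set lgroup) v h.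
     Wstar H v \<and> Wstar_morphism G u H v h \<and> K = kernel G H h)"

definition lquot :: "'a lgroup \<Rightarrow> 'a set \<Rightarrow> 'a set lgroup" where
  "lquot G M = \<lparr>carrier = carrier (G Mod M), mult = mult (G Mod M), one = one (G Mod M),
     lle = (\<lambda>A B. \<exists>a\<in>A. \<exists>b\<in>B. lle G a b)\<rparr>"

definition real_lgroup :: "real lgroup" where
  "real_lgroup = \<lparr>carrier = UNIV, mult = (+), one = 0, lle = (\<le>)\<rparr>"

definition YG :: "'a lgroup \<Rightarrow> 'a \<Rightarrow> 'a set set" where
  "YG G u = {M. lideal G M \<and> u \<notin> M \<and> (\<forall>N. lideal G N \<and> u \<notin> N \<and> M \<subseteq> N \<longrightarrow> N = M)}"

text \<open>
  The closed sets of the hull-kernel topology are the hulls \<open>{M. A \<subseteq> M}\<close>, so it is the topology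
  generated by the complements of the hulls.
\<close>

definition YG_top :: "'a lgroup \<Rightarrow> 'a \<Rightarrow> 'a set topology" where
  "YG_top G u = topology_generated_by {{M \<in> YG G u. \<not> A \<subseteq> M} | A. A \<subseteq> carrier G}"

text \<open>
  The value \<open>g(M)\<close>: the image of the coset of \<open>g\<close> under the unique embedding of \<open>G/M\<close> into the
  reals that maps the coset of \<open>u\<close> to \<open>1\<close>. As a HOL function, the embedding is unique only
  on the cosets, hence the description picks the value rather than the function.
\<close>

definition yosida :: "'a lgroup \<Rightarrow> 'a \<Rightarrow> 'a \<Rightarrow> 'a set \<Rightarrow> real" where
  "yosida G u g M = (THE r. \<exists>\<phi>. \<phi> \<in> lgroup_hom (lquot G M) real_lgroup \<and>
     inj_on \<phi> (carrier (lquot G M)) \<and> \<phi> (M #>\<^bsub>G\<^esub> u) = 1 \<and> r = \<phi> (M #>\<^bsub>G\<^esub> g))"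

definition coz :: "'a lgroup \<Rightarrow> 'a \<Rightarrow> 'a \<Rightarrow> 'a set set" where
  "coz G u g = {M \<in> YG G u. yosida G u g M \<noteq> 0}"

definition Zset :: "'a lgroup \<Rightarrow> 'a \<Rightarrow> 'a \<Rightarrow> 'a set set" where
  "Zset G u g = YG G u - coz G u g"

definition Iset :: "'a lgroup \<Rightarrow> 'a \<Rightarrow> 'a set set \<Rightarrow> 'a set" where
  "Iset G u S = {g \<in> carrier G. S \<subseteq> Zset G u g}"

definition Mpoint :: "'a lgroup \<Rightarrow> 'a \<Rightarrow> 'a set \<Rightarrow> 'a set" where
  "Mpoint G u p = {g \<in> carrier G. yosida G u g p = 0}"

definition CR :: "'a lgroup \<Rightarrow> 'a \<Rightarrow> bool" where
  "CR G u \<longleftrightarrow> (\<forall>g\<in>carrier G.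
     coz G u g = YG_top G u interior_of (YG_top G u closure_of coz G u g))"


lemma carrier_lorder [simp]: "carrier (lorder G) = carrier G"
  and le_lorder [simp]: "le (lorder G) = lle G"
  and eq_lorder [simp]: "eq (lorder G) = (=)"
  by (simp_all add: lorder_def)

lemma lattice_lorder_iff:
  "lattice (lorder G) \<longleftrightarrow>
     (\<forall>x\<in>carrier G. lle G x x) \<and>
     (\<forall>x\<in>carrier G. \<forall>y\<in>carrier G. lle G x y \<and> lle G y x \<longrightarrow> x = y) \<and>
     (\<forall>x\<in>carrier G. \<forall>y\<in>carrier G. \<forall>z\<in>carrier G. lle G x y \<and> lle G y z \<longrightarrow> lle G x z) \<and>
     (\<forall>x\<in>carrier G. \<forall>y\<in>carrier G. (\<exists>s. least (lorder G) s (Upper (lorder G) {x, y})) \<and>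
        (\<exists>s. greatest (lorder G) s (Lower (lorder G) {x, y})))" (is "?L \<longleftrightarrow> ?R")
proof
  assume ?L
  then interpret lattice "lorder G" .
  show ?R
  proof (intro conjI ballI impI)
    fix x y z
    assume "x \<in> carrier G" "y \<in> carrier G" "z \<in> carrier G" "lle G x y \<and> lle G y z"
    then show "lle G x z"
      using le_trans[of x y z] by simp
  next
    fix x y assume "x \<in> carrier G" "y \<in> carrier G" "lle G x y \<and> lle G y x"
    then show "x = y"
      using le_antisym[of x y] by simp
  qed (use le_refl sup_of_two_exists inf_of_two_exists in simp_all)
next
  assume ?R
  then have rfl: "\<And>x. x \<in> carrier G \<Longrightarrow> lle G x x"
    and antisym: "\<And>x y. x \<in> carrier G \<Longrightarrow> y \<in> carrier G \<Longrightarrow> lle G x y \<Longrightarrow> lle G y x \<Longrightarrow> x = y"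
    and trans: "\<And>x y z. lle G x y \<Longrightarrow> lle G y z \<Longrightarrow> x \<in> carrier G \<Longrightarrow> y \<in> carrier G \<Longrightarrow>
      z \<in> carrier G \<Longrightarrow> lle G x z"
    and sup: "\<And>x y. x \<in> carrier G \<Longrightarrow> y \<in> carrier G \<Longrightarrow>
      \<exists>s. least (lorder G) s (Upper (lorder G) {x, y})"
    and inf: "\<And>x y. x \<in> carrier G \<Longrightarrow> y \<in> carrier G \<Longrightarrow>
      \<exists>s. greatest (lorder G) s (Lower (lorder G) {x, y})"
    by blast+
  show ?L
    by unfold_locales
      (simp_all add: rfl antisym sup inf, (erule trans; assumption)?)
qed

lemma least_Upper_lorder_iff:
  assumes "x \<in> carrier G" "y \<in> carrier G"
  shows "least (lorder G) s (Upper (lorder G) {x, y}) \<longleftrightarrow>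
     s \<in> carrier G \<and> lle G x s \<and> lle G y s \<and>
     (\<forall>z\<in>carrier G. lle G x z \<and> lle G y z \<longrightarrow> lle G s z)"
  using assms by (auto simp: least_def Upper_def)

lemma greatest_Lower_lorder_iff:
  assumes "x \<in> carrier G" "y \<in> carrier G"
  shows "greatest (lorder G) s (Lower (lorder G) {x, y}) \<longleftrightarrow>
     s \<in> carrier G \<and> lle G s x \<and> lle G s y \<and>
     (\<forall>z\<in>carrier G. lle G z x \<and> lle G z y \<longrightarrow> lle G z s)"
  using assms by (auto simp: greatest_def Lower_def)

lemma lsup_props:
  assumes "lattice (lorder G)" "x \<in> carrier G" "y \<in> carrier G"
  shows "lsup G x y \<in> carrier G" "lle G x (lsup G x y)" "lle G y (lsup G x y)"
    "\<And>z. z \<in> carrier G \<Longrightarrow> lle G x z \<Longrightarrow> lle G y z \<Longrightarrow> lle G (lsup G x y) z"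
proof -
  have "\<exists>s. least (lorder G) s (Upper (lorder G) {x, y})"
    using assms unfolding lattice_lorder_iff by blast
  then have "least (lorder G) (lsup G x y) (Upper (lorder G) {x, y})"
    unfolding lsup_def join_def sup_def by (rule someI_ex)
  then show "lsup G x y \<in> carrier G" "lle G x (lsup G x y)" "lle G y (lsup G x y)"
    "\<And>z. z \<in> carrier G \<Longrightarrow> lle G x z \<Longrightarrow> lle G y z \<Longrightarrow> lle G (lsup G x y) z"
    by (simp_all add: least_Upper_lorder_iff assms)
qed

lemma linf_props:
  assumes "lattice (lorder G)" "x \<in> carrier G" "y \<in> carrier G"
  shows "linf G x y \<in> carrier G" "lle G (linf G x y) x" "lle G (linf G x y) y"
    "\<And>z. z \<in> carrier G \<Longrightarrow> lle G z x \<Longrightarrow> lle G z y \<Longrightarrow> lle G z (linf G x y)"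
proof -
  have "\<exists>s. greatest (lorder G) s (Lower (lorder G) {x, y})"
    using assms unfolding lattice_lorder_iff by blast
  then have "greatest (lorder G) (linf G x y) (Lower (lorder G) {x, y})"
    unfolding linf_def meet_def inf_def by (rule someI_ex)
  then show "linf G x y \<in> carrier G" "lle G (linf G x y) x" "lle G (linf G x y) y"
    "\<And>z. z \<in> carrier G \<Longrightarrow> lle G z x \<Longrightarrow> lle G z y \<Longrightarrow> lle G z (linf G x y)"
    by (simp_all add: greatest_Lower_lorder_iff assms)
qed

lemma lattice_antisym:
  assumes "lattice (lorder G)" "lle G x y" "lle G y x" "x \<in> carrier G" "y \<in> carrier G"
  shows "x = y"
  using assms unfolding lattice_lorder_iff by blast

lemma lattice_refl:
  assumes "lattice (lorder G)" "x \<in> carrier G"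
  shows "lle G x x"
  using assms unfolding lattice_lorder_iff by blast

lemma Wstar_embedding:
  fixes Q :: "'c lgroup" and H :: "'b lgroup"
  assumes H: "Wstar H v" and inj: "inj_on \<psi> (carrier Q)"
    and hom: "\<psi> \<in> hom Q H"
    and mult: "\<And>A B. A \<in> carrier Q \<Longrightarrow> B \<in> carrier Q \<Longrightarrow> A \<otimes>\<^bsub>Q\<^esub> B \<in> carrier Q"
    and one: "\<one>\<^bsub>Q\<^esub> \<in> carrier Q" "\<psi> \<one>\<^bsub>Q\<^esub> = \<one>\<^bsub>H\<^esub>"
    and inv: "\<And>A. A \<in> carrier Q \<Longrightarrow> \<exists>B\<in>carrier Q. \<psi> B = inv\<^bsub>H\<^esub> \<psi> A"
    and le: "\<And>A B. A \<in> carrier Q \<Longrightarrow> B \<in> carrier Q \<Longrightarrow> lle Q A B \<longleftrightarrow> lle H (\<psi> A) (\<psi> B)"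
    and jn: "\<And>A B. A \<in> carrier Q \<Longrightarrow> B \<in> carrier Q \<Longrightarrow> \<exists>C\<in>carrier Q. \<psi> C = lsup H (\<psi> A) (\<psi> B)"
    and mt: "\<And>A B. A \<in> carrier Q \<Longrightarrow> B \<in> carrier Q \<Longrightarrow> \<exists>C\<in>carrier Q. \<psi> C = linf H (\<psi> A) (\<psi> B)"
    and w: "w \<in> carrier Q" "\<psi> w = v"
  shows "Wstar Q w \<and> \<psi> \<in> lgroup_hom Q H"
proof -
  have cH: "comm_group H" and lH: "lattice (lorder H)" and aH: "archimedean H"
    and sH: "strong_unit H v"
    and mono: "\<And>x y z. x \<in> carrier H \<Longrightarrow> y \<in> carrier H \<Longrightarrow> z \<in> carrier H \<Longrightarrow> lle H x y \<Longrightarrow>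
      lle H (x \<otimes>\<^bsub>H\<^esub> z) (y \<otimes>\<^bsub>H\<^esub> z)"
    using H by (auto simp: Wstar_def abelian_lgroup_def)
  interpret H: comm_group H by (fact cH)
  have cl: "\<psi> A \<in> carrier H" if "A \<in> carrier Q" for A
    using hom that by (auto simp: hom_def)
  have mu: "\<psi> (A \<otimes>\<^bsub>Q\<^esub> B) = \<psi> A \<otimes>\<^bsub>H\<^esub> \<psi> B" if "A \<in> carrier Q" "B \<in> carrier Q" for A B
    using hom that by (auto simp: hom_def)
  have eqI: "A = B" if "A \<in> carrier Q" "B \<in> carrier Q" "\<psi> A = \<psi> B" for A B
    using inj that by (auto simp: inj_on_def)
  have cQ: "comm_group Q"
  proof (rule comm_groupI)
    fix x assume x: "x \<in> carrier Q"
    then obtain y where "y \<in> carrier Q" "\<psi> y = inv\<^bsub>H\<^esub> \<psi> x"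
      using inv by blast
    then show "\<exists>y\<in>carrier Q. y \<otimes>\<^bsub>Q\<^esub> x = \<one>\<^bsub>Q\<^esub>"
      using x by (intro bexI[of _ y] eqI) (simp_all add: mult one mu cl)
  qed (auto intro!: eqI simp: mult one mu cl H.m_ac)
  then interpret Q: comm_group Q .
  interpret gh: group_hom Q H \<psi>
    by unfold_locales (fact hom)
  have luQ: "least (lorder Q) C (Upper (lorder Q) {A, B})"
    if "A \<in> carrier Q" "B \<in> carrier Q" "C \<in> carrier Q" "\<psi> C = lsup H (\<psi> A) (\<psi> B)" for A B C
    using that lsup_props[OF lH cl[OF that(1)] cl[OF that(2)]]
    by (auto simp: least_Upper_lorder_iff le cl)
  have glQ: "greatest (lorder Q) C (Lower (lorder Q) {A, B})"
    if "A \<in> carrier Q" "B \<in> carrier Q" "C \<in> carrier Q" "\<psi> C = linf H (\<psi> A) (\<psi> B)" for A B C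
    using that linf_props[OF lH cl[OF that(1)] cl[OF that(2)]]
    by (auto simp: greatest_Lower_lorder_iff le cl)
  have lQ: "lattice (lorder Q)"
    unfolding lattice_lorder_iff
  proof (intro conjI ballI impI)
    fix x assume "x \<in> carrier Q"
    then show "lle Q x x"
      using lH cl by (simp add: le lattice_lorder_iff)
  next
    fix x y assume "x \<in> carrier Q" "y \<in> carrier Q" "lle Q x y \<and> lle Q y x"
    then show "x = y"
      using lattice_antisym[OF lH, of "\<psi> x" "\<psi> y"] by (intro eqI) (auto simp: le cl)
  next
    fix x y z assume "x \<in> carrier Q" "y \<in> carrier Q" "z \<in> carrier Q" "lle Q x y \<and> lle Q y z"
    moreover have "lle H a c"
      if "a \<in> carrier H" "b \<in> carrier H" "c \<in> carrier H" "lle H a b" "lle H b c" for a b c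
      using lH that unfolding lattice_lorder_iff by blast
    ultimately show "lle Q x z"
      by (metis cl le)
  next
    fix x y assume "x \<in> carrier Q" "y \<in> carrier Q"
    then show "\<exists>s. least (lorder Q) s (Upper (lorder Q) {x, y})"
      "\<exists>s. greatest (lorder Q) s (Lower (lorder Q) {x, y})"
      using luQ glQ jn mt by meson+
  qed
  have psi_sup: "\<psi> (lsup Q A B) = lsup H (\<psi> A) (\<psi> B)"
    if AB: "A \<in> carrier Q" "B \<in> carrier Q" for A B
  proof -
    obtain C where C: "C \<in> carrier Q" "\<psi> C = lsup H (\<psi> A) (\<psi> B)"
      using jn[OF AB] by blast
    have "lsup Q A B = C"
      using luQ[OF AB C] lsup_props[OF lQ AB] C AB
      by (intro lattice_antisym[OF lQ]) (auto simp: least_Upper_lorder_iff)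
    then show ?thesis using C by simp
  qed
  have psi_inf: "\<psi> (linf Q A B) = linf H (\<psi> A) (\<psi> B)"
    if AB: "A \<in> carrier Q" "B \<in> carrier Q" for A B
  proof -
    obtain C where C: "C \<in> carrier Q" "\<psi> C = linf H (\<psi> A) (\<psi> B)"
      using mt[OF AB] by blast
    have "linf Q A B = C"
      using glQ[OF AB C] linf_props[OF lQ AB] C AB
      by (intro lattice_antisym[OF lQ]) (auto simp: greatest_Lower_lorder_iff)
    then show ?thesis using C by simp
  qed
  have psi_abs: "\<psi> (labs Q A) = labs H (\<psi> A)" and abs_cl: "labs Q A \<in> carrier Q"
    if "A \<in> carrier Q" for A
    using that by (simp_all add: labs_def psi_sup lsup_props[OF lQ])
  have "\<psi> \<in> lgroup_hom Q H"
    using hom psi_sup psi_inf by (simp add: lgroup_hom_def)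
  moreover have "abelian_lgroup Q"
    unfolding abelian_lgroup_def using cQ lQ
    by (auto simp: le cl mult mu intro!: mono)
  moreover have "archimedean Q"
    unfolding archimedean_def
  proof (intro ballI impI)
    fix a b assume ab: "a \<in> carrier Q" "b \<in> carrier Q"
      and "lle Q \<one>\<^bsub>Q\<^esub> a \<and> (\<forall>n::nat. lle Q (a [^]\<^bsub>Q\<^esub> n) b)"
    then have "lle H \<one>\<^bsub>H\<^esub> (\<psi> a) \<and> (\<forall>n::nat. lle H (\<psi> a [^]\<^bsub>H\<^esub> n) (\<psi> b))"
      by (simp add: le gh.hom_nat_pow)
    then have "\<psi> a = \<one>\<^bsub>H\<^esub>"
      using aH cl ab unfolding archimedean_def by blast
    then show "a = \<one>\<^bsub>Q\<^esub>"
      using ab by (intro eqI) simp_all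
  qed
  moreover have "strong_unit Q w"
    unfolding strong_unit_def
  proof (intro conjI)
    show "lle Q \<one>\<^bsub>Q\<^esub> w"
      using sH w by (simp add: le strong_unit_def)
    show "principal_lideal Q w = carrier Q"
    proof (intro equalityI subsetI)
      fix A assume A: "A \<in> carrier Q"
      then have "\<psi> A \<in> principal_lideal H v"
        using sH cl by (simp add: strong_unit_def)
      then obtain n :: nat where "0 < n" "lle H (labs H (\<psi> A)) (labs H v [^]\<^bsub>H\<^esub> n)"
        by (auto simp: principal_lideal_def)
      then show "A \<in> principal_lideal Q w"
        using A w by (auto simp: principal_lideal_def le abs_cl psi_abs gh.hom_nat_pow)
    qed (simp add: principal_lideal_def)
  qed (fact w)
  ultimately show ?thesis
    by (simp add: Wstar_def)
qed

lemma Wstar_kernelI: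
  fixes G :: "'a lgroup" and H :: "'b lgroup"
  assumes G: "Wstar G u" and H: "Wstar H v" and h: "Wstar_morphism G u H v h"
  shows "Wstar_kernel G u (kernel G H h)"
proof -
  define K where "K = kernel G H h"
  define Q where "Q = lquot G K"
  define \<psi> where "\<psi> X = the_elem (h ` X)" for X
  have cG: "comm_group G" and lG: "lattice (lorder G)" and u: "u \<in> carrier G"
    using G by (auto simp: Wstar_def abelian_lgroup_def strong_unit_def)
  have cH: "comm_group H" and lH: "lattice (lorder H)"
    using H by (auto simp: Wstar_def abelian_lgroup_def)
  interpret G: comm_group G by (fact cG)
  interpret H: comm_group H by (fact cH)
  have hom: "h \<in> hom G H" and hu: "h u = v"
    and hsup: "\<And>x y. x \<in> carrier G \<Longrightarrow> y \<in> carrier G \<Longrightarrow> h (lsup G x y) = lsup H (h x) (h y)"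
    and hinf: "\<And>x y. x \<in> carrier G \<Longrightarrow> y \<in> carrier G \<Longrightarrow> h (linf G x y) = linf H (h x) (h y)"
    using h by (auto simp: Wstar_morphism_def lgroup_hom_def)
  interpret gh: group_hom G H h
    by unfold_locales (fact hom)
  interpret K: normal K G
    unfolding K_def by (fact gh.normal_kernel)
  have carQ: "carrier Q = (\<lambda>x. K #>\<^bsub>G\<^esub> x) ` carrier G"
    by (simp add: Q_def lquot_def carrier_FactGroup)
  have mem: "y \<in> K #>\<^bsub>G\<^esub> x \<longleftrightarrow> y \<in> carrier G \<and> h y = h x" if x: "x \<in> carrier G" for x y
  proof
    assume "y \<in> K #>\<^bsub>G\<^esub> x"
    then obtain k where "k \<in> K" and y: "y = k \<otimes>\<^bsub>G\<^esub> x"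
      unfolding r_coset_def by blast
    then have "k \<in> carrier G" "h k = \<one>\<^bsub>H\<^esub>"
      unfolding K_def kernel_def by simp_all
    then show "y \<in> carrier G \<and> h y = h x"
      using x y by simp
  next
    assume y: "y \<in> carrier G \<and> h y = h x"
    define k where "k = y \<otimes>\<^bsub>G\<^esub> inv\<^bsub>G\<^esub> x"
    have "k \<in> carrier G" "h k = h y \<otimes>\<^bsub>H\<^esub> inv\<^bsub>H\<^esub> h x"
      using x y unfolding k_def by simp_all
    then have "k \<in> K"
      using x y unfolding K_def kernel_def by simp
    moreover have "y = k \<otimes>\<^bsub>G\<^esub> x"
      using x y unfolding k_def by (simp add: G.m_assoc)
    ultimately show "y \<in> K #>\<^bsub>G\<^esub> x"
      unfolding r_coset_def by blast
  qed
  have psi: "\<psi> (K #>\<^bsub>G\<^esub> x) = h x" if x: "x \<in> carrier G" for x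
  proof -
    have "h ` (K #>\<^bsub>G\<^esub> x) = {h x}"
    proof (intro equalityI subsetI)
      fix z assume "z \<in> {h x}"
      moreover have "x \<in> K #>\<^bsub>G\<^esub> x"
        using x by (simp add: mem)
      ultimately show "z \<in> h ` (K #>\<^bsub>G\<^esub> x)"
        by simp
    qed (use x in \<open>auto simp: mem\<close>)
    then show ?thesis by (simp add: \<psi>_def)
  qed
  have hmono: "lle H (h a) (h b)"
    if "a \<in> carrier G" "b \<in> carrier G" "lle G a b" for a b
  proof -
    have "lle G a a"
      using lattice_refl[OF lG that(1)] .
    then have "linf G a b = a"
      using that linf_props[OF lG that(1,2)] by (intro lattice_antisym[OF lG]) auto
    then have "linf H (h a) (h b) = h a"
      using hinf[OF that(1,2)] by simp
    then show ?thesis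
      using linf_props(3)[OF lH, of "h a" "h b"] that by simp
  qed
  have le: "lle Q A B \<longleftrightarrow> lle H (\<psi> A) (\<psi> B)" if AB: "A \<in> carrier Q" "B \<in> carrier Q" for A B
  proof -
    obtain x y where x: "x \<in> carrier G" "A = K #>\<^bsub>G\<^esub> x" and y: "y \<in> carrier G" "B = K #>\<^bsub>G\<^esub> y"
      using AB unfolding carQ by blast
    have "lle Q A B \<longleftrightarrow> (\<exists>a\<in>A. \<exists>b\<in>B. lle G a b)"
      by (simp add: Q_def lquot_def)
    also have "\<dots> \<longleftrightarrow> lle H (h x) (h y)"
    proof
      assume "\<exists>a\<in>A. \<exists>b\<in>B. lle G a b"
      then obtain a b where ab: "a \<in> A" "b \<in> B" "lle G a b" by blast
      then have "a \<in> carrier G" "h a = h x" "b \<in> carrier G" "h b = h y"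
        using x y mem by simp_all
      then show "lle H (h x) (h y)"
        using hmono[of a b] ab(3) by simp
    next
      assume le: "lle H (h x) (h y)"
      have "lle H (h x) (h x)"
        using lattice_refl[OF lH] x by simp
      then have "linf H (h x) (h y) = h x"
        by (intro lattice_antisym[OF lH] linf_props[OF lH])
          (use x(1) y(1) le in simp_all)
      then have "linf G x y \<in> A"
        using x y linf_props(1)[OF lG x(1) y(1)] hinf[OF x(1) y(1)] by (simp add: mem)
      moreover have "y \<in> B"
        using y by (simp add: mem)
      ultimately show "\<exists>a\<in>A. \<exists>b\<in>B. lle G a b"
        using linf_props(3)[OF lG x(1) y(1)] by blast
    qed
    finally show ?thesis
      using x y by (simp add: psi)
  qed
  have multQ: "(K #>\<^bsub>G\<^esub> x) \<otimes>\<^bsub>Q\<^esub> (K #>\<^bsub>G\<^esub> y) = K #>\<^bsub>G\<^esub> (x \<otimes>\<^bsub>G\<^esub> y)"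
    if "x \<in> carrier G" "y \<in> carrier G" for x y
    using that by (simp add: Q_def lquot_def K.rcos_sum)
  have oneQ: "\<one>\<^bsub>Q\<^esub> = K #>\<^bsub>G\<^esub> \<one>\<^bsub>G\<^esub>"
    using K.subset by (simp add: Q_def lquot_def G.coset_mult_one)
  have q_eq: "K #>\<^bsub>G\<^esub> x = K #>\<^bsub>G\<^esub> y"
    if "x \<in> carrier G" "y \<in> carrier G" "h x = h y" for x y
    by (rule Set.set_eqI) (simp add: mem that)
  have psi_inj: "A = B" if AB: "A \<in> carrier Q" "B \<in> carrier Q" and "\<psi> A = \<psi> B" for A B
  proof -
    obtain x y where "x \<in> carrier G" "A = K #>\<^bsub>G\<^esub> x" "y \<in> carrier G" "B = K #>\<^bsub>G\<^esub> y"
      using AB unfolding carQ by blast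
    then show ?thesis
      using that(3) q_eq[of x y] by (simp add: psi)
  qed
  have inj_Q: "inj_on \<psi> (carrier Q)"
    using psi_inj by (rule inj_onI)
  have hom_Q: "\<psi> \<in> hom Q H"
    unfolding hom_def carQ using multQ psi by auto
  have inv_Q: "\<exists>B\<in>carrier Q. \<psi> B = inv\<^bsub>H\<^esub> \<psi> A" if "A \<in> carrier Q" for A
  proof -
    obtain x where x: "x \<in> carrier G" "A = K #>\<^bsub>G\<^esub> x"
      using \<open>A \<in> carrier Q\<close> unfolding carQ by blast
    then have "\<psi> (K #>\<^bsub>G\<^esub> inv\<^bsub>G\<^esub> x) = inv\<^bsub>H\<^esub> \<psi> A"
      by (simp add: psi)
    moreover have "K #>\<^bsub>G\<^esub> inv\<^bsub>G\<^esub> x \<in> carrier Q"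
      using x(1) unfolding carQ by simp
    ultimately show ?thesis by blast
  qed
  have jn_Q: "\<exists>C\<in>carrier Q. \<psi> C = lsup H (\<psi> A) (\<psi> B)"
    if AB: "A \<in> carrier Q" "B \<in> carrier Q" for A B
  proof -
    obtain x y where x: "x \<in> carrier G" "A = K #>\<^bsub>G\<^esub> x" and y: "y \<in> carrier G" "B = K #>\<^bsub>G\<^esub> y"
      using AB unfolding carQ by blast
    have m: "lsup G x y \<in> carrier G"
      using lsup_props(1)[OF lG x(1) y(1)] .
    then have "\<psi> (K #>\<^bsub>G\<^esub> lsup G x y) = lsup H (\<psi> A) (\<psi> B)"
      using x y by (simp add: psi hsup)
    moreover have "K #>\<^bsub>G\<^esub> lsup G x y \<in> carrier Q"
      using m unfolding carQ by simp
    ultimately show ?thesis by blast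
  qed
  have mt_Q: "\<exists>C\<in>carrier Q. \<psi> C = linf H (\<psi> A) (\<psi> B)"
    if AB: "A \<in> carrier Q" "B \<in> carrier Q" for A B
  proof -
    obtain x y where x: "x \<in> carrier G" "A = K #>\<^bsub>G\<^esub> x" and y: "y \<in> carrier G" "B = K #>\<^bsub>G\<^esub> y"
      using AB unfolding carQ by blast
    have m: "linf G x y \<in> carrier G"
      using linf_props(1)[OF lG x(1) y(1)] .
    then have "\<psi> (K #>\<^bsub>G\<^esub> linf G x y) = linf H (\<psi> A) (\<psi> B)"
      using x y by (simp add: psi hinf)
    moreover have "K #>\<^bsub>G\<^esub> linf G x y \<in> carrier Q"
      using m unfolding carQ by simp
    ultimately show ?thesis by blast
  qed
  have one_Q: "\<psi> \<one>\<^bsub>Q\<^esub> = \<one>\<^bsub>H\<^esub>"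
    unfolding oneQ by (subst psi) simp_all
  have mult_Q: "A \<otimes>\<^bsub>Q\<^esub> B \<in> carrier Q" if "A \<in> carrier Q" "B \<in> carrier Q" for A B
    using that by (auto simp: carQ multQ)
  have one_cl_Q: "\<one>\<^bsub>Q\<^esub> \<in> carrier Q"
    unfolding oneQ carQ by (rule imageI) simp
  have w_Q: "K #>\<^bsub>G\<^esub> u \<in> carrier Q" "\<psi> (K #>\<^bsub>G\<^esub> u) = v"
    using u hu by (auto simp: carQ psi)
  have Q: "Wstar Q (K #>\<^bsub>G\<^esub> u) \<and> \<psi> \<in> lgroup_hom Q H"
    by (rule Wstar_embedding[OF H inj_Q hom_Q mult_Q one_cl_Q one_Q inv_Q le jn_Q mt_Q w_Q])
  define q where "q x = K #>\<^bsub>G\<^esub> x" for x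
  have lQ: "lattice (lorder Q)"
    using Q by (simp add: Wstar_def abelian_lgroup_def)
  have q_cl: "q x \<in> carrier Q" if "x \<in> carrier G" for x
    using that unfolding carQ q_def by (rule imageI)
  have "q (lsup G x y) = lsup Q (q x) (q y) \<and> q (linf G x y) = linf Q (q x) (q y)"
    if xy: "x \<in> carrier G" "y \<in> carrier G" for x y
  proof -
    have "\<psi> (lsup Q (q x) (q y)) = lsup H (\<psi> (q x)) (\<psi> (q y))"
      "\<psi> (linf Q (q x) (q y)) = linf H (\<psi> (q x)) (\<psi> (q y))"
      using Q q_cl xy by (auto simp: lgroup_hom_def)
    then show ?thesis
      using psi_inj[of "q (lsup G x y)" "lsup Q (q x) (q y)"]
        psi_inj[of "q (linf G x y)" "linf Q (q x) (q y)"]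
        lsup_props(1)[OF lG xy] linf_props(1)[OF lG xy]
        lsup_props(1)[OF lQ q_cl[OF xy(1)] q_cl[OF xy(2)]]
        linf_props(1)[OF lQ q_cl[OF xy(1)] q_cl[OF xy(2)]]
        q_cl psi hsup[OF xy] hinf[OF xy] xy
      by (simp add: q_def)
  qed
  then have "Wstar_morphism G u Q (K #>\<^bsub>G\<^esub> u) q"
    using q_cl multQ unfolding Wstar_morphism_def lgroup_hom_def hom_def q_def by simp
  moreover have "K = kernel G Q q"
  proof (rule Set.set_eqI)
    fix x
    have "x \<in> kernel G Q q \<longleftrightarrow> x \<in> carrier G \<and> \<psi> (q x) = \<psi> \<one>\<^bsub>Q\<^esub>"
      using psi_inj[of "q x" "\<one>\<^bsub>Q\<^esub>"] q_cl oneQ q_cl[OF G.one_closed]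
      unfolding kernel_def q_def by auto
    also have "\<dots> \<longleftrightarrow> x \<in> K"
      unfolding one_Q K_def kernel_def using psi by (auto simp: q_def)
    finally show "x \<in> K \<longleftrightarrow> x \<in> kernel G Q q" by simp
  qed
  ultimately show ?thesis
    using Q unfolding Wstar_kernel_def K_def by blast
qed

end

theory Submission
  imports Defs
begin

text \<open>
  Evaluation at \<open>M\<close> vanishes exactly on \<open>M\<close> (Hoelder's embedding of the Archimedean totally ordered
  group \<open>G/M\<close> into the reals), so \<open>coz g\<close> is the set of all \<open>M\<close> not containing \<open>g\<close>. The cozero sets form
  a base, and two of them are disjoint iff the elements are; hence \<open>f\<close> lies in the bipolar of \<open>g\<close> iff
  \<open>coz f\<close> is contained in the closure of \<open>coz g\<close>, and the interior of this closure is the union of these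
  \<open>coz f\<close>. Every condition then says that \<open>coz f\<close> is contained in \<open>coz g\<close> whenever \<open>f\<close> is in the bipolar
  of \<open>g\<close>. For the units: if \<open>g\<close> is in \<open>M\<close> but \<open>f\<close> is not, then a large multiple of \<open>f\<close> exceeds
  \<open>u\<close> up to some \<open>m \<ge> 0\<close> in \<open>M\<close>, and \<open>|g| + m\<close> is a weak unit that is not strong.
\<close>

section \<open>Abelian lattice-ordered groups\<close>

text \<open>The value \<open>yosida G u g M\<close> is a definite description, so locating its zeros
  needs uniqueness of the embedding as well as existence. Both come from one family of integer
  inequalities: \<open>val\<close> is defined as a rational cut, and any additive map that is
  nonnegative on the cosets \<ge> 0 and sends \<open>u\<close> to 1 is squeezed by the same cut.

  The Archimedean property of \<open>G\<close> acts through \<open>YG_separates\<close>: the maximal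
  ideals meet in 0, and this turns disjointness of cozero sets into disjointness of elements.

  On the ideal side, \<open>I(Z(g))\<close>, the kernels and the \<open>M_p\<close> are all of the
  form \<open>Iset G u S\<close>. For a kernel the obstacle is that its morphism may fail to be
  surjective. Maximal ideals of the target still pull back to maximal ideals of \<open>G\<close>,
  and those of the target meet in 0 as well, so the kernel is an intersection of points of
  \<open>YG G u\<close>.\<close>

locale ab_lgroup = comm_group G for G :: "'a lgroup" (structure) +
  assumes lat: "lattice (lorder G)"
    and mult_right_mono: "\<lbrakk>x \<in> carrier G; y \<in> carrier G; z \<in> carrier G; lle G x y\<rbrakk>
      \<Longrightarrow> lle G (x \<otimes> z) (y \<otimes> z)"
begin

abbreviation le_G (infix "\<preceq>" 50) where "x \<preceq> y \<equiv> lle G x y"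
abbreviation "ppart x \<equiv> lsup G x \<one>"

lemmas sup_closed [simp, intro] = lsup_props(1)[OF lat]
  and sup_ge1 = lsup_props(2)[OF lat]
  and sup_ge2 = lsup_props(3)[OF lat]
  and sup_least = lsup_props(4)[OF lat]
  and inf_closed [simp, intro] = linf_props(1)[OF lat]
  and inf_le1 = linf_props(2)[OF lat]
  and inf_le2 = linf_props(3)[OF lat]
  and inf_greatest = linf_props(4)[OF lat]
  and le_refl [simp] = lattice_refl[OF lat]
  and le_antisym = lattice_antisym[OF lat]

lemma le_trans:
  "\<lbrakk>x \<preceq> y; y \<preceq> z; x \<in> carrier G; y \<in> carrier G; z \<in> carrier G\<rbrakk> \<Longrightarrow> x \<preceq> z"
  using lat unfolding lattice_lorder_iff by blast

lemma abs_closed [simp, intro]: "x \<in> carrier G \<Longrightarrow> labs G x \<in> carrier G"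
  by (simp add: labs_def)

lemma mult_left_mono:
  "\<lbrakk>x \<preceq> y; x \<in> carrier G; y \<in> carrier G; z \<in> carrier G\<rbrakk> \<Longrightarrow> z \<otimes> x \<preceq> z \<otimes> y"
  using mult_right_mono[of x y z] by (simp add: m_comm)

lemma mult_mono:
  assumes "x \<preceq> y" "z \<preceq> w" "x \<in> carrier G" "y \<in> carrier G" "z \<in> carrier G" "w \<in> carrier G"
  shows "x \<otimes> z \<preceq> y \<otimes> w"
proof (rule le_trans)
  show "x \<otimes> z \<preceq> y \<otimes> z" "y \<otimes> z \<preceq> y \<otimes> w"
    using assms by (simp_all add: mult_right_mono mult_left_mono)
qed (use assms in simp_all)

lemma le_iff_one_le:
  assumes "x \<in> carrier G" "y \<in> carrier G"
  shows "x \<preceq> y \<longleftrightarrow> \<one> \<preceq> y \<otimes> inv x"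
proof
  assume "x \<preceq> y"
  then show "\<one> \<preceq> y \<otimes> inv x"
    using mult_right_mono[of x y "inv x"] assms by simp
next
  assume "\<one> \<preceq> y \<otimes> inv x"
  then show "x \<preceq> y"
    using mult_right_mono[of \<one> "y \<otimes> inv x" x] assms by (simp add: m_assoc)
qed

lemma inv_le_inv_iff:
  "\<lbrakk>x \<in> carrier G; y \<in> carrier G\<rbrakk> \<Longrightarrow> inv x \<preceq> inv y \<longleftrightarrow> y \<preceq> x"
  by (simp add: le_iff_one_le[of "inv x"] le_iff_one_le[of y] m_comm)

lemma inv_le_iff:
  "\<lbrakk>x \<in> carrier G; y \<in> carrier G\<rbrakk> \<Longrightarrow> inv x \<preceq> y \<longleftrightarrow> inv y \<preceq> x"
  using inv_le_inv_iff[of x "inv y"] by simp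

lemma le_mult_iff:
  assumes "x \<in> carrier G" "y \<in> carrier G" "z \<in> carrier G"
  shows "x \<preceq> y \<otimes> z \<longleftrightarrow> x \<otimes> inv z \<preceq> y"
proof -
  have "x \<preceq> y \<otimes> z \<longleftrightarrow> \<one> \<preceq> y \<otimes> z \<otimes> inv x"
    using assms by (intro le_iff_one_le) simp_all
  also have "y \<otimes> z \<otimes> inv x = y \<otimes> inv (x \<otimes> inv z)"
    using assms by (simp add: inv_mult m_ac)
  also have "\<one> \<preceq> \<dots> \<longleftrightarrow> x \<otimes> inv z \<preceq> y"
    using assms by (simp add: le_iff_one_le[of "x \<otimes> inv z" y])
  finally show ?thesis .
qed

lemma le_mult_iff':
  "\<lbrakk>x \<in> carrier G; y \<in> carrier G; z \<in> carrier G\<rbrakk> \<Longrightarrow> x \<preceq> z \<otimes> y \<longleftrightarrow> x \<otimes> inv z \<preceq> y"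
  by (subst m_comm) (simp_all add: le_mult_iff)

lemma mult_nonneg:
  "\<lbrakk>\<one> \<preceq> x; \<one> \<preceq> y; x \<in> carrier G; y \<in> carrier G\<rbrakk> \<Longrightarrow> \<one> \<preceq> x \<otimes> y"
  using mult_mono[of \<one> x \<one> y] by simp

lemma pow_nonneg: "\<lbrakk>\<one> \<preceq> x; x \<in> carrier G\<rbrakk> \<Longrightarrow> \<one> \<preceq> x [^] (n::nat)"
  by (induction n) (simp_all add: mult_nonneg)

lemma le_mult_nonneg_right:
  "\<lbrakk>x \<preceq> y; \<one> \<preceq> z; x \<in> carrier G; y \<in> carrier G; z \<in> carrier G\<rbrakk> \<Longrightarrow> x \<preceq> y \<otimes> z"
  using mult_mono[of x y \<one> z] by simp

lemma le_mult_nonneg_left: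
  "\<lbrakk>x \<preceq> y; \<one> \<preceq> z; x \<in> carrier G; y \<in> carrier G; z \<in> carrier G\<rbrakk> \<Longrightarrow> x \<preceq> z \<otimes> y"
  using mult_mono[of \<one> z x y] by simp

lemma pow_mono:
  "\<lbrakk>x \<preceq> y; x \<in> carrier G; y \<in> carrier G\<rbrakk> \<Longrightarrow> x [^] (n::nat) \<preceq> y [^] n"
  by (induction n) (simp_all add: mult_mono)

section \<open>Positive parts and absolute values\<close>

lemma ppart_nonneg: "x \<in> carrier G \<Longrightarrow> \<one> \<preceq> ppart x"
  by (rule sup_ge2) simp_all

lemma le_ppart: "x \<in> carrier G \<Longrightarrow> x \<preceq> ppart x"
  by (rule sup_ge1) simp_all

lemma ppart_eq_one_iff: "x \<in> carrier G \<Longrightarrow> ppart x = \<one> \<longleftrightarrow> x \<preceq> \<one>"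
  by (metis le_antisym le_ppart le_refl one_closed ppart_nonneg sup_closed sup_least)

text \<open>Translation by \<open>x\<close> carries the pair \<open>inv x\<close>,
  \<open>\<one>\<close> to the pair \<open>\<one>\<close>, \<open>x\<close>, hence one supremum to
  the other. This is the decomposition into positive and negative part, free of subtraction.\<close>

lemma mult_ppart_inv:
  assumes x: "x \<in> carrier G"
  shows "x \<otimes> ppart (inv x) = ppart x"
proof (rule le_antisym)
  show "ppart x \<preceq> x \<otimes> ppart (inv x)"
  proof (rule sup_least)
    show "x \<preceq> x \<otimes> ppart (inv x)"
      using mult_left_mono[OF ppart_nonneg[of "inv x"], of x] x by simp
    show "\<one> \<preceq> x \<otimes> ppart (inv x)"
      using mult_left_mono[OF le_ppart[of "inv x"], of x] x by simp
  qed (use x in simp_all)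
  have "ppart (inv x) \<preceq> ppart x \<otimes> inv x"
  proof (rule sup_least)
    show "inv x \<preceq> ppart x \<otimes> inv x"
      using mult_right_mono[OF _ _ _ ppart_nonneg, of x "inv x"] x by simp
    show "\<one> \<preceq> ppart x \<otimes> inv x"
      using mult_right_mono[OF _ _ _ le_ppart, of x "inv x"] x by simp
  qed (use x in simp_all)
  then show "x \<otimes> ppart (inv x) \<preceq> ppart x"
    using le_mult_iff[of "ppart (inv x)" "ppart x" "inv x"] x by (simp add: m_comm)
qed (use x in simp_all)

text \<open>Lowering \<open>ppart (inv x)\<close> by the infimum \<open>?d\<close> still leaves an
  upper bound of \<open>inv x\<close> and \<open>\<one>\<close>, so minimality of the supremum
  forces \<open>?d \<preceq> \<one>\<close>.\<close>

lemma inf_ppart_inv: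
  assumes x: "x \<in> carrier G"
  shows "linf G (ppart x) (ppart (inv x)) = \<one>" (is "?d = _")
proof (rule le_antisym)
  have "?d \<otimes> inv (ppart (inv x)) \<preceq> x"
    using le_mult_iff[of ?d x "ppart (inv x)"] inf_le1[of "ppart x" "ppart (inv x)"] x
    by (simp add: mult_ppart_inv)
  then have 1: "inv x \<preceq> ppart (inv x) \<otimes> inv ?d"
    using x inv_le_inv_iff[of x "?d \<otimes> inv (ppart (inv x))"] by (simp add: inv_mult m_comm)
  have 2: "\<one> \<preceq> ppart (inv x) \<otimes> inv ?d"
    using le_iff_one_le[of ?d "ppart (inv x)"] inf_le2[of "ppart x" "ppart (inv x)"] x by simp
  have "ppart (inv x) \<preceq> ppart (inv x) \<otimes> inv ?d"
    using 1 2 x by (intro sup_least) simp_all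
  then have "inv (ppart (inv x)) \<otimes> ppart (inv x) \<preceq> inv (ppart (inv x)) \<otimes> (ppart (inv x) \<otimes> inv ?d)"
    using x by (intro mult_left_mono) simp_all
  then have "\<one> \<preceq> inv ?d"
    using x by (simp add: m_assoc[symmetric])
  then show "?d \<preceq> \<one>"
    using x inv_le_inv_iff[of \<one> ?d] inv_le_inv_iff[of ?d \<one>] by simp
qed (use x in \<open>simp_all add: inf_greatest ppart_nonneg\<close>)

text \<open>From \<open>inv s \<preceq> s\<close> the negative part lies below the positive part;
  being disjoint from it, it vanishes. This serves \<open>abs_nonneg\<close>, where adding the
  bounds of \<open>x\<close> and \<open>inv x\<close> controls only twice the absolute
  value.\<close>

lemma nonneg_of_square:
  assumes s: "s \<in> carrier G" and "\<one> \<preceq> s \<otimes> s"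
  shows "\<one> \<preceq> s"
proof -
  define n where "n = ppart (inv s)"
  have n: "n \<in> carrier G" "\<one> \<preceq> n"
    using s by (simp_all add: n_def ppart_nonneg)
  have "inv s \<preceq> s"
    using le_iff_one_le[of "inv s" s] assms by simp
  then have "n \<preceq> ppart s"
    unfolding n_def using s sup_ge1[of s \<one>]
    by (intro sup_least) (auto intro: le_trans[OF _ le_ppart] simp: ppart_nonneg)
  then have "n \<preceq> linf G (ppart s) n"
    using n s by (intro inf_greatest) simp_all
  then have "n = \<one>"
    using inf_ppart_inv[OF s] n by (intro le_antisym) (simp_all add: n_def)
  then show ?thesis
    using s inv_le_iff[of s \<one>] by (simp add: n_def ppart_eq_one_iff)
qed

lemma abs_nonneg:
  assumes x: "x \<in> carrier G"
  shows "\<one> \<preceq> labs G x"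
proof (rule nonneg_of_square)
  have "x \<otimes> inv x \<preceq> labs G x \<otimes> labs G x"
    using x unfolding labs_def by (intro mult_mono sup_ge1 sup_ge2) simp_all
  then show "\<one> \<preceq> labs G x \<otimes> labs G x"
    using x by simp
qed (use x in simp)

lemma le_abs: "x \<in> carrier G \<Longrightarrow> x \<preceq> labs G x"
  and inv_le_abs: "x \<in> carrier G \<Longrightarrow> inv x \<preceq> labs G x"
  unfolding labs_def by (simp_all add: sup_ge1 sup_ge2)

lemma abs_le_iff:
  assumes "x \<in> carrier G" "y \<in> carrier G"
  shows "labs G x \<preceq> y \<longleftrightarrow> x \<preceq> y \<and> inv x \<preceq> y"
  using assms by (metis abs_closed inv_closed inv_le_abs labs_def le_abs le_trans sup_least)

lemma abs_of_nonneg: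
  assumes "x \<in> carrier G" "\<one> \<preceq> x"
  shows "labs G x = x"
proof (rule le_antisym)
  have "inv x \<preceq> x"
    using assms inv_le_inv_iff[of x \<one>] le_trans[of "inv x" \<one> x] by simp
  then show "labs G x \<preceq> x"
    using assms by (simp add: abs_le_iff)
qed (use assms in \<open>simp_all add: le_abs\<close>)

lemma abs_eq_one:
  assumes "x \<in> carrier G" "labs G x = \<one>"
  shows "x = \<one>"
proof -
  have "x \<preceq> \<one>" "inv x \<preceq> \<one>"
    using le_abs[of x] inv_le_abs[of x] assms by simp_all
  then show ?thesis
    using assms by (intro le_antisym) (simp_all add: inv_le_iff[of x])
qed

section \<open>Disjoint elements\<close>

lemma inf_eq_one_mono:
  assumes "linf G b c = \<one>" "\<one> \<preceq> a" "a \<preceq> b" "\<one> \<preceq> c"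
    "a \<in> carrier G" "b \<in> carrier G" "c \<in> carrier G"
  shows "linf G a c = \<one>"
proof (rule le_antisym)
  have "linf G a c \<preceq> linf G b c"
    using assms inf_le1[of a c] inf_le2[of a c]
    by (intro inf_greatest) (auto intro: le_trans)
  then show "linf G a c \<preceq> \<one>"
    using assms by simp
qed (use assms in \<open>simp_all add: inf_greatest\<close>)

lemma inf_commute: "\<lbrakk>a \<in> carrier G; b \<in> carrier G\<rbrakk> \<Longrightarrow> linf G a b = linf G b a"
  by (intro le_antisym inf_greatest inf_le1 inf_le2) simp_all

text \<open>Subtracting \<open>b\<close> from the infimum leaves something below both
  \<open>a\<close> and \<open>c\<close>, hence \<le> 0. So the infimum is below \<open>b\<close> as
  well as \<open>a\<close>, hence again \<le> 0.\<close>

lemma inf_mult_eq_one: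
  assumes "linf G a b = \<one>" "linf G a c = \<one>" "\<one> \<preceq> a" "\<one> \<preceq> b" "\<one> \<preceq> c"
    "a \<in> carrier G" "b \<in> carrier G" "c \<in> carrier G"
  shows "linf G a (b \<otimes> c) = \<one>" (is "?d = _")
proof (rule le_antisym)
  have d: "?d \<preceq> a" "?d \<preceq> b \<otimes> c"
    using assms inf_le1[of a "b \<otimes> c"] inf_le2[of a "b \<otimes> c"] by simp_all
  have "?d \<otimes> inv b \<preceq> linf G a c"
  proof (rule inf_greatest)
    show "?d \<otimes> inv b \<preceq> a"
      using d assms le_mult_iff[of ?d a b] le_mult_nonneg_right[of ?d a b] by simp
    show "?d \<otimes> inv b \<preceq> c"
      using d assms le_mult_iff'[of ?d c b] by simp
  qed (use assms in simp_all)
  then have "?d \<preceq> b"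
    using assms le_mult_iff[of ?d \<one> b] by simp
  then have "?d \<preceq> linf G a b"
    using d assms by (intro inf_greatest) simp_all
  then show "?d \<preceq> \<one>"
    using assms by simp
qed (use assms in \<open>simp_all add: inf_greatest mult_nonneg\<close>)

lemma inf_pow_eq_one:
  assumes "linf G a b = \<one>" "\<one> \<preceq> a" "\<one> \<preceq> b" "a \<in> carrier G" "b \<in> carrier G"
  shows "linf G a (b [^] (n::nat)) = \<one>"
proof (induction n)
  case 0
  then show ?case
    using assms by (intro le_antisym inf_greatest) (simp_all add: inf_le2)
qed (use assms in \<open>simp add: inf_mult_eq_one pow_nonneg\<close>)

lemma inf_mult_le:
  assumes "m \<in> carrier G" "a \<in> carrier G" "b \<in> carrier G"
  shows "linf G (m \<otimes> a) (m \<otimes> b) \<preceq> m \<otimes> linf G a b" (is "?d \<preceq> _")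
proof -
  have "?d \<preceq> m \<otimes> a" "?d \<preceq> m \<otimes> b"
    using assms by (simp_all add: inf_le1 inf_le2)
  then have "?d \<otimes> inv m \<preceq> linf G a b"
    using assms le_mult_iff'[of ?d a m] le_mult_iff'[of ?d b m]
    by (intro inf_greatest) simp_all
  then show ?thesis
    using assms le_mult_iff'[of ?d "linf G a b" m] by simp
qed

section \<open>Ideals\<close>

lemma lideal_closed:
  assumes "lideal G I"
  shows "x \<in> I \<Longrightarrow> x \<in> carrier G" "\<one> \<in> I" "x \<in> I \<Longrightarrow> inv x \<in> I"
    "\<lbrakk>x \<in> I; y \<in> I\<rbrakk> \<Longrightarrow> x \<otimes> y \<in> I" "\<lbrakk>x \<in> I; y \<in> I\<rbrakk> \<Longrightarrow> lsup G x y \<in> I"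
    "\<lbrakk>x \<in> I; y \<in> I\<rbrakk> \<Longrightarrow> linf G x y \<in> I" "x \<in> I \<Longrightarrow> x [^] (n::nat) \<in> I"
proof -
  interpret I: subgroup I G
    using assms unfolding lideal_def by (rule conjunct1)
  show "x \<in> I \<Longrightarrow> x \<in> carrier G" "\<one> \<in> I" "x \<in> I \<Longrightarrow> inv x \<in> I"
    "\<lbrakk>x \<in> I; y \<in> I\<rbrakk> \<Longrightarrow> x \<otimes> y \<in> I" "\<lbrakk>x \<in> I; y \<in> I\<rbrakk> \<Longrightarrow> lsup G x y \<in> I"
    "\<lbrakk>x \<in> I; y \<in> I\<rbrakk> \<Longrightarrow> linf G x y \<in> I"
    using assms[unfolded lideal_def, THEN conjunct2, THEN conjunct1] by simp_all
  show "x \<in> I \<Longrightarrow> x [^] n \<in> I"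
    by (induction n) simp_all
qed

lemma lideal_convex:
  "\<lbrakk>lideal G I; x \<in> I; y \<in> I; z \<in> carrier G; x \<preceq> z; z \<preceq> y\<rbrakk> \<Longrightarrow> z \<in> I"
  unfolding lideal_def by blast

lemma lideal_abs_iff:
  assumes "lideal G I" "x \<in> carrier G"
  shows "labs G x \<in> I \<longleftrightarrow> x \<in> I"
proof
  assume *: "labs G x \<in> I"
  show "x \<in> I"
    using lideal_convex[OF assms(1) lideal_closed(3)[OF assms(1) *] * assms(2)]
      assms(2) le_abs[of x] inv_le_abs[of x] inv_le_iff[of x "labs G x"] by simp
qed (use assms in \<open>auto simp: labs_def lideal_closed\<close>)

lemma polar_iff:
  "f \<in> polar G g \<longleftrightarrow> f \<in> carrier G \<and> linf G (labs G f) (labs G g) = \<one>"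
  by (simp add: polar_def)

lemma lideal_Inter:
  assumes "\<And>M. M \<in> S \<Longrightarrow> lideal G M"
  shows "lideal G {x \<in> carrier G. \<forall>M\<in>S. x \<in> M}"
  unfolding lideal_def
proof (intro conjI ballI impI)
  let ?I = "{x \<in> carrier G. \<forall>M\<in>S. x \<in> M}"
  show "subgroup ?I G"
  proof (rule subgroupI)
    show "?I \<noteq> {}"
      using assms lideal_closed(2) by blast
    show "inv x \<in> ?I" if "x \<in> ?I" for x
      using that by (simp add: lideal_closed(3)[OF assms])
    show "x \<otimes> y \<in> ?I" if "x \<in> ?I" "y \<in> ?I" for x y
      using that by (simp add: lideal_closed(4)[OF assms])
  qed simp
  fix x y assume xy: "x \<in> ?I" "y \<in> ?I"
  then show "lsup G x y \<in> ?I" "linf G x y \<in> ?I"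
    by (simp_all add: lideal_closed(5,6)[OF assms])
  fix z assume z: "z \<in> carrier G" "x \<preceq> z \<and> z \<preceq> y"
  have "z \<in> M" if "M \<in> S" for M
    using lideal_convex[OF assms[OF that], of x y z] xy z that by simp
  then show "z \<in> ?I"
    using z by simp
qed

text \<open>The ideal generated by an ideal \<open>M\<close> and an element \<open>a \<ge> 0\<close>.\<close>

definition adjoin where
  "adjoin M a = {x \<in> carrier G. \<exists>m\<in>M. \<exists>n::nat. \<one> \<preceq> m \<and> x \<preceq> m \<otimes> a [^] n \<and> inv x \<preceq> m \<otimes> a [^] n}"

lemma adjoin_lideal:
  assumes M: "lideal G M" and a: "a \<in> carrier G" "\<one> \<preceq> a"
  shows "lideal G (adjoin M a)" "M \<subseteq> adjoin M a" "a \<in> adjoin M a"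
proof -
  note Mc = lideal_closed[OF M]
  \<comment> \<open>Adding the bounds of \<open>x\<close> and \<open>y\<close> gives a single
    element above both, their inverses, their product and \<open>\<one>\<close>. Each closure
    property then compares with that one bound.\<close>
  have common: "\<exists>m\<in>M. \<exists>n::nat. \<one> \<preceq> m \<and> \<one> \<preceq> m \<otimes> a [^] n \<and> x \<preceq> m \<otimes> a [^] n \<and> y \<preceq> m \<otimes> a [^] n \<and>
      inv x \<preceq> m \<otimes> a [^] n \<and> inv y \<preceq> m \<otimes> a [^] n \<and>
      x \<otimes> y \<preceq> m \<otimes> a [^] n \<and> inv (x \<otimes> y) \<preceq> m \<otimes> a [^] n"
    if xy: "x \<in> adjoin M a" "y \<in> adjoin M a" for x y
  proof -
    obtain m n where m: "m \<in> M" "\<one> \<preceq> m" "x \<preceq> m \<otimes> a [^] (n::nat)" "inv x \<preceq> m \<otimes> a [^] n"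
      and x: "x \<in> carrier G"
      using xy by (auto simp: adjoin_def)
    obtain m' n' where m': "m' \<in> M" "\<one> \<preceq> m'" "y \<preceq> m' \<otimes> a [^] (n'::nat)" "inv y \<preceq> m' \<otimes> a [^] n'"
      and y: "y \<in> carrier G"
      using xy by (auto simp: adjoin_def)
    define b where "b = m \<otimes> a [^] n"
    define c where "c = m' \<otimes> a [^] n'"
    have mc: "m \<in> carrier G" "m' \<in> carrier G"
      using m m' Mc by auto
    have bc: "b \<in> carrier G" "c \<in> carrier G" "\<one> \<preceq> b" "\<one> \<preceq> c"
      "x \<preceq> b" "inv x \<preceq> b" "y \<preceq> c" "inv y \<preceq> c"
      using m m' mc a by (simp_all add: b_def c_def mult_nonneg pow_nonneg)
    have e: "(m \<otimes> m') \<otimes> a [^] (n + n') = b \<otimes> c"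
      using mc a by (simp add: b_def c_def nat_pow_mult[symmetric] m_ac)
    show ?thesis
    proof (intro bexI exI[of _ "n + n'"])
      show "m \<otimes> m' \<in> M"
        using m m' Mc by simp
    qed (use m m' mc bc x y e in \<open>simp_all add: mult_nonneg le_mult_nonneg_left
        le_mult_nonneg_right mult_mono inv_mult\<close>)
  qed
  have inv: "inv x \<in> adjoin M a" if "x \<in> adjoin M a" for x
    using that by (auto simp: adjoin_def)
  have sup: "lsup G x y \<in> adjoin M a" if xy: "x \<in> adjoin M a" "y \<in> adjoin M a" for x y
  proof -
    have c: "x \<in> carrier G" "y \<in> carrier G"
      using xy by (auto simp: adjoin_def)
    obtain m n where m: "m \<in> M" "\<one> \<preceq> m" "x \<preceq> m \<otimes> a [^] (n::nat)" "y \<preceq> m \<otimes> a [^] n"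
        "inv x \<preceq> m \<otimes> a [^] n"
      using common[OF xy] by blast
    have mc: "m \<in> carrier G" using m Mc by auto
    have "inv (lsup G x y) \<preceq> inv x"
      using c by (simp add: inv_le_inv_iff sup_ge1)
    then have "inv (lsup G x y) \<preceq> m \<otimes> a [^] n"
      using m mc a c le_trans[of "inv (lsup G x y)" "inv x" "m \<otimes> a [^] n"] by simp
    moreover have "lsup G x y \<preceq> m \<otimes> a [^] n"
      using m mc a c by (intro sup_least) simp_all
    ultimately show ?thesis
      using m c unfolding adjoin_def by blast
  qed
  have inf: "linf G x y \<in> adjoin M a" if xy: "x \<in> adjoin M a" "y \<in> adjoin M a" for x y
  proof -
    have c: "x \<in> carrier G" "y \<in> carrier G"
      using xy by (auto simp: adjoin_def)
    obtain m n where m: "m \<in> M" "\<one> \<preceq> m" "x \<preceq> m \<otimes> a [^] (n::nat)" "inv y \<preceq> m \<otimes> a [^] n"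
        "inv x \<preceq> m \<otimes> a [^] n"
      using common[OF xy] by blast
    have mc: "m \<in> carrier G" using m Mc by auto
    have "inv (m \<otimes> a [^] n) \<preceq> linf G x y"
      using m mc a c inv_le_iff[of x "m \<otimes> a [^] n"] inv_le_iff[of y "m \<otimes> a [^] n"]
      by (intro inf_greatest) simp_all
    then have "inv (linf G x y) \<preceq> m \<otimes> a [^] n"
      using m mc a c inv_le_iff[of "linf G x y" "m \<otimes> a [^] n"] by simp
    moreover have "linf G x y \<preceq> m \<otimes> a [^] n"
      using m mc a c inf_le1[of x y] le_trans[of "linf G x y" x "m \<otimes> a [^] n"] by simp
    ultimately show ?thesis
      using m c unfolding adjoin_def by blast
  qed
  show M_sub: "M \<subseteq> adjoin M a"
  proof
    fix x assume x: "x \<in> M"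
    then have xc: "x \<in> carrier G" using Mc by auto
    have "labs G x \<preceq> labs G x \<otimes> a [^] (0::nat)"
      using xc by simp
    moreover have "labs G x \<in> M"
      using x xc by (simp add: lideal_abs_iff[OF M])
    ultimately show "x \<in> adjoin M a"
      using xc le_abs[of x] inv_le_abs[of x] abs_nonneg[of x]
      unfolding adjoin_def by (auto intro!: bexI[of _ "labs G x"] exI[of _ "0::nat"])
  qed
  show "a \<in> adjoin M a"
  proof -
    have "inv a \<preceq> a"
      using a abs_of_nonneg[of a] inv_le_abs[of a] by simp
    then show ?thesis
      using a Mc(2) unfolding adjoin_def by (auto intro!: bexI[of _ \<one>] exI[of _ "1::nat"])
  qed
  show "lideal G (adjoin M a)"
    unfolding lideal_def
  proof (intro conjI ballI impI)
    show "subgroup (adjoin M a) G"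
    proof (rule subgroupI)
      show "adjoin M a \<subseteq> carrier G" by (auto simp: adjoin_def)
      show "adjoin M a \<noteq> {}" using M_sub Mc(2) by auto
      show "x \<otimes> y \<in> adjoin M a" if "x \<in> adjoin M a" "y \<in> adjoin M a" for x y
      proof -
        have "x \<otimes> y \<in> carrier G"
          using that by (auto simp: adjoin_def)
        then show ?thesis
          using common[OF that] unfolding adjoin_def by blast
      qed
    qed (rule inv)
  next
    fix x y z assume xy: "x \<in> adjoin M a" "y \<in> adjoin M a" and z: "z \<in> carrier G" "x \<preceq> z \<and> z \<preceq> y"
    have c: "x \<in> carrier G" "y \<in> carrier G"
      using xy by (auto simp: adjoin_def)
    obtain m n where m: "m \<in> M" "\<one> \<preceq> m" "y \<preceq> m \<otimes> a [^] (n::nat)" "inv x \<preceq> m \<otimes> a [^] n"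
      using common[OF xy] by blast
    have mc: "m \<in> carrier G" using m Mc by auto
    have "inv z \<preceq> inv x"
      using z c by (simp add: inv_le_inv_iff)
    then have "inv z \<preceq> m \<otimes> a [^] n"
      using m mc a c z le_trans[of "inv z" "inv x" "m \<otimes> a [^] n"] by simp
    moreover have "z \<preceq> m \<otimes> a [^] n"
      using m mc a c z le_trans[of z y "m \<otimes> a [^] n"] by simp
    ultimately show "z \<in> adjoin M a"
      using m z unfolding adjoin_def by blast
  qed (simp_all add: sup inf)
qed

lemma lideal_triv: "lideal G {\<one>}"
  unfolding lideal_def
proof (intro conjI ballI impI)
  show "subgroup {\<one>} G" by (rule triv_subgroup)
qed (auto intro!: le_antisym sup_least inf_greatest sup_ge1 inf_le1)

lemma lideal_Union_chain:
  assumes "subset.chain {M. lideal G M} C" "C \<noteq> {}"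
  shows "lideal G (\<Union>C)"
proof -
  have C: "lideal G M" if "M \<in> C" for M
    using assms that by (auto simp: subset.chain_def)
  have two: "\<exists>M\<in>C. x \<in> M \<and> y \<in> M" if xy: "x \<in> \<Union>C" "y \<in> \<Union>C" for x y
  proof -
    obtain M N where "M \<in> C" "N \<in> C" "x \<in> M" "y \<in> N"
      using xy by blast
    moreover have "M \<subseteq> N \<or> N \<subseteq> M"
      using assms \<open>M \<in> C\<close> \<open>N \<in> C\<close> by (auto simp: subset_chain_def)
    ultimately show ?thesis by blast
  qed
  show ?thesis
    unfolding lideal_def
  proof (intro conjI ballI impI)
    show "subgroup (\<Union>C) G"
    proof (rule subgroupI)
      show "\<Union>C \<subseteq> carrier G" using C lideal_closed(1) by blast
      show "\<Union>C \<noteq> {}" using assms(2) C lideal_closed(2) by blast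
      show "inv x \<in> \<Union>C" if "x \<in> \<Union>C" for x
        using that C lideal_closed(3) by blast
      show "x \<otimes> y \<in> \<Union>C" if "x \<in> \<Union>C" "y \<in> \<Union>C" for x y
        using two[OF that] C lideal_closed(4) by blast
    qed
    fix x y assume xy: "x \<in> \<Union>C" "y \<in> \<Union>C"
    show "lsup G x y \<in> \<Union>C" "linf G x y \<in> \<Union>C"
      using two[OF xy] C lideal_closed(5,6) by blast+
    fix z assume "z \<in> carrier G" "x \<preceq> z \<and> z \<preceq> y"
    then show "z \<in> \<Union>C"
      using two[OF xy] C lideal_convex by blast
  qed
qed

section \<open>Maximal ideals\<close>

lemma exists_YG:
  assumes I: "lideal G I" "u \<notin> I"
  shows "\<exists>M\<in>YG G u. I \<subseteq> M"
proof -
  \<comment> \<open>Zorn runs only over ideals above \<open>I\<close>. A competitor of the resulting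
    \<open>M\<close> contains \<open>M\<close>, hence \<open>I\<close>, so maximality in
    \<open>A\<close> is maximality among all ideals that omit \<open>u\<close>.\<close>
  define A where "A = {M. lideal G M \<and> u \<notin> M \<and> I \<subseteq> M}"
  have "\<exists>M\<in>A. \<forall>X\<in>A. M \<subseteq> X \<longrightarrow> X = M"
  proof (rule subset_Zorn_nonempty)
    show "A \<noteq> {}" using I by (auto simp: A_def)
    show "\<Union>C \<in> A" if "C \<noteq> {}" "subset.chain A C" for C
    proof -
      have "subset.chain {M. lideal G M} C"
        using that by (auto simp: subset_chain_def A_def)
      then have "lideal G (\<Union>C)"
        using lideal_Union_chain that by blast
      then show ?thesis
        using that by (auto simp: A_def subset_chain_def)
    qed
  qed
  then obtain M where M: "M \<in> A" and mx: "\<And>X. X \<in> A \<Longrightarrow> M \<subseteq> X \<Longrightarrow> X = M"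
    by blast
  have "M \<in> YG G u"
    unfolding YG_def
  proof (intro CollectI conjI allI impI)
    fix N assume N: "lideal G N \<and> u \<notin> N \<and> M \<subseteq> N"
    then have "N \<in> A"
      using M by (auto simp: A_def)
    then show "N = M"
      using mx N by blast
  qed (use M in \<open>simp_all add: A_def\<close>)
  then show ?thesis
    using M by (auto simp: A_def)
qed

lemma YG_lideal: "M \<in> YG G u \<Longrightarrow> lideal G M"
  and YG_unit: "M \<in> YG G u \<Longrightarrow> u \<notin> M"
  by (simp_all add: YG_def)

text \<open>Maximality forces \<open>u\<close> into the ideal generated by \<open>M\<close> and
  \<open>a\<close>. Modulo \<open>M\<close>, some multiple of \<open>a\<close> therefore exceeds
  \<open>u\<close>: this is the Archimedean property of \<open>G/M\<close> that Hoelder's embedding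
  needs.\<close>

lemma YG_cofinal:
  assumes M: "M \<in> YG G u" and a: "a \<in> carrier G" "\<one> \<preceq> a" "a \<notin> M"
  shows "\<exists>m\<in>M. \<exists>n::nat. \<one> \<preceq> m \<and> u \<preceq> m \<otimes> a [^] n"
proof -
  note adj = adjoin_lideal[OF YG_lideal[OF M] a(1,2)]
  have "u \<in> adjoin M a"
    using M adj a(3) unfolding YG_def by blast
  then show ?thesis
    unfolding adjoin_def by blast
qed

text \<open>A converse of \<open>YG_cofinal\<close>: a larger ideal contains some absolute value
  outside \<open>P\<close>, and the bound on \<open>u\<close> then pulls \<open>u\<close> into it by
  convexity. It serves to show that preimages of maximal ideals are maximal.\<close>

lemma YG_I:
  assumes P: "lideal G P" "u \<notin> P" and u: "u \<in> carrier G" "\<one> \<preceq> u"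
    and cof: "\<And>a. a \<in> carrier G \<Longrightarrow> \<one> \<preceq> a \<Longrightarrow> a \<notin> P \<Longrightarrow> \<exists>m\<in>P. \<exists>n::nat. u \<preceq> m \<otimes> a [^] n"
  shows "P \<in> YG G u"
  unfolding YG_def
proof (intro CollectI conjI allI impI)
  fix N assume "lideal G N \<and> u \<notin> N \<and> P \<subseteq> N"
  then have N: "lideal G N" "u \<notin> N" "P \<subseteq> N" by simp_all
  show "N = P"
  proof (rule ccontr)
    assume "N \<noteq> P"
    then obtain x where x: "x \<in> N" "x \<notin> P" using N by blast
    then have xc: "x \<in> carrier G" using lideal_closed(1)[OF N(1)] by blast
    have "labs G x \<notin> P" "labs G x \<in> N"
      using x xc by (simp_all add: lideal_abs_iff P N)
    then obtain m n where m: "m \<in> P" "u \<preceq> m \<otimes> labs G x [^] (n::nat)"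
      using cof[of "labs G x"] xc abs_nonneg[of x] by auto
    have "m \<otimes> labs G x [^] n \<in> N"
      using m N(3) \<open>labs G x \<in> N\<close> by (intro lideal_closed(4,7)[OF N(1)]) auto
    then have "u \<in> N"
      using lideal_convex[OF N(1) lideal_closed(2)[OF N(1)]] u m by blast
    then show False using N by simp
  qed
qed (use P in simp_all)

text \<open>If both stayed outside \<open>M\<close>, multiples of both would exceed \<open>u\<close>
  up to corrections \<open>m\<close> and \<open>m'\<close>. Enlarging each bound by the other
  correction gives both the translate \<open>m \<otimes> m'\<close>, and the infimum that remains
  after it is 0, so \<open>u\<close> would lie in \<open>M\<close>.\<close>

lemma YG_prime:
  assumes M: "M \<in> YG G u" and u: "u \<in> carrier G" "\<one> \<preceq> u"
    and ab: "a \<in> carrier G" "b \<in> carrier G" "\<one> \<preceq> a" "\<one> \<preceq> b" "linf G a b = \<one>"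
  shows "a \<in> M \<or> b \<in> M"
proof (rule ccontr)
  assume "\<not> (a \<in> M \<or> b \<in> M)"
  then obtain m n m' n' where m: "m \<in> M" "\<one> \<preceq> m" "u \<preceq> m \<otimes> a [^] (n::nat)"
    and m': "m' \<in> M" "\<one> \<preceq> m'" "u \<preceq> m' \<otimes> b [^] (n'::nat)"
    using YG_cofinal[OF M, of a] YG_cofinal[OF M, of b] ab by blast
  note Mc = lideal_closed[OF YG_lideal[OF M]]
  have mc: "m \<in> carrier G" "m' \<in> carrier G" using m m' Mc by auto
  have "u \<preceq> m' \<otimes> (m \<otimes> a [^] n)" "u \<preceq> m \<otimes> (m' \<otimes> b [^] n')"
    using m m' mc ab u by (simp_all add: le_mult_nonneg_left)
  then have "u \<preceq> (m \<otimes> m') \<otimes> a [^] n" "u \<preceq> (m \<otimes> m') \<otimes> b [^] n'"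
    using mc ab by (simp_all add: m_ac)
  then have "u \<preceq> linf G ((m \<otimes> m') \<otimes> a [^] n) ((m \<otimes> m') \<otimes> b [^] n')"
    using mc ab u by (intro inf_greatest) simp_all
  moreover have "linf G ((m \<otimes> m') \<otimes> a [^] n) ((m \<otimes> m') \<otimes> b [^] n') \<preceq> (m \<otimes> m') \<otimes> linf G (a [^] n) (b [^] n')"
    using mc ab by (intro inf_mult_le) simp_all
  moreover have "linf G (a [^] n) (b [^] n') = \<one>"
    using ab inf_pow_eq_one[of b a n] inf_pow_eq_one[of "a [^] n" b n']
    by (simp add: inf_commute pow_nonneg)
  ultimately have "u \<preceq> m \<otimes> m'"
    using mc u ab by (auto intro: le_trans)
  then have "u \<in> M"
    using lideal_convex[OF YG_lideal[OF M] Mc(2) Mc(4)] m m' u by blast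
  then show False using YG_unit[OF M] by simp
qed

end

section \<open>Real values modulo a maximal ideal\<close>

text \<open>An error that does not grow with \<open>n\<close> disappears after division by
  \<open>n\<close>. It absorbs the rounding of \<open>n * val x\<close> to an integer.\<close>

lemma real_le_if_multiples_le:
  fixes a b c :: real
  assumes "\<And>n::int. 0 < n \<Longrightarrow> of_int n * a \<le> of_int n * b + c"
  shows "a \<le> b"
proof (rule ccontr)
  assume "\<not> a \<le> b"
  then obtain n :: nat where "c < real n * (a - b)"
    using reals_Archimedean3[of "a - b"] by auto
  moreover from this \<open>\<not> a \<le> b\<close> have "real n * (a - b) \<le> real (Suc n) * (a - b)"
    by (intro mult_right_mono) auto
  ultimately show False
    using assms[of "int (Suc n)"] by (simp add: algebra_simps)
qed

locale max_lideal = ab_lgroup G for G :: "'a lgroup" (structure) +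
  fixes u :: 'a and M :: "'a set"
  assumes u_closed [simp, intro]: "u \<in> carrier G"
    and u_nonneg: "\<one> \<preceq> u"
    and u_strong: "x \<in> carrier G \<Longrightarrow> \<exists>n::nat. x \<preceq> u [^] n"
    and M: "M \<in> YG G u"
begin

lemmas M_ideal = YG_lideal[OF M]
lemmas Mc = lideal_closed[OF M_ideal]

text \<open>The elements whose cosets are \<open>\<ge> 0\<close> in \<open>G/M\<close>.\<close>

definition cone where "cone = {x \<in> carrier G. \<exists>m\<in>M. m \<preceq> x}"

text \<open>Hoelder's cut: the supremum of the rationals \<open>m / n\<close> for which
  \<open>m u \<le> n x\<close> holds modulo \<open>M\<close>. It is defined on elements of
  \<open>G\<close>, so cosets appear only once the arithmetic is done.\<close>

definition val :: "'a \<Rightarrow> real" where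
  "val x = Sup {of_int m / of_int n | m n :: int. 0 < n \<and> x [^] n \<otimes> inv (u [^] m) \<in> cone}"

lemma cone_closed [dest]: "x \<in> cone \<Longrightarrow> x \<in> carrier G"
  by (simp add: cone_def)

lemma M_cone: "x \<in> M \<Longrightarrow> x \<in> cone"
  using Mc(1) le_refl unfolding cone_def by blast

lemma nonneg_cone: "\<one> \<preceq> x \<Longrightarrow> x \<in> carrier G \<Longrightarrow> x \<in> cone"
  using Mc(2) unfolding cone_def by blast

lemma cone_mult: "x \<in> cone \<Longrightarrow> y \<in> cone \<Longrightarrow> x \<otimes> y \<in> cone"
proof -
  assume "x \<in> cone" "y \<in> cone"
  then obtain m m' where m: "m \<in> M" "m' \<in> M" "m \<preceq> x" "m' \<preceq> y"
    and c: "x \<in> carrier G" "y \<in> carrier G"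
    unfolding cone_def by blast
  moreover have "m \<otimes> m' \<preceq> x \<otimes> y"
    using m c Mc(1) by (intro mult_mono) simp_all
  ultimately show ?thesis
    using Mc(4) unfolding cone_def by blast
qed

lemma cone_pow: "x \<in> cone \<Longrightarrow> 0 \<le> n \<Longrightarrow> x [^] (n::int) \<in> cone"
proof -
  assume x: "x \<in> cone" and "0 \<le> n"
  then obtain k where n: "n = int k"
    using nonneg_int_cases by blast
  have "x [^] k \<in> cone"
    using x by (induction k) (auto intro: cone_mult M_cone simp: Mc)
  then show ?thesis
    by (simp add: n int_pow_int)
qed

text \<open>Positive and negative part of \<open>x\<close> are disjoint, so the prime ideal
  \<open>M\<close> contains one of them. The inverse of that one is a lower bound in
  \<open>M\<close> for \<open>inv x\<close> or for \<open>x\<close>, respectively.\<close>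

lemma cone_total:
  assumes x: "x \<in> carrier G" "x \<notin> cone"
  shows "inv x \<in> cone"
proof -
  have "ppart x \<in> M \<or> ppart (inv x) \<in> M"
    using x by (intro YG_prime[OF M] ppart_nonneg inf_ppart_inv u_nonneg) simp_all
  moreover have "inv (ppart x) \<preceq> inv x" "inv (ppart (inv x)) \<preceq> x"
    using x le_ppart[of x] le_ppart[of "inv x"] inv_le_inv_iff[of "ppart x" x] inv_le_iff[of x]
    by simp_all
  ultimately show ?thesis
    using x Mc(3) unfolding cone_def by blast
qed

lemma cone_antisym:
  assumes "x \<in> cone" "inv x \<in> cone"
  shows "x \<in> M"
proof -
  obtain m m' where m: "m \<in> M" "m' \<in> M" "m \<preceq> x" "m' \<preceq> inv x" and x: "x \<in> carrier G"
    using assms unfolding cone_def by blast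
  then have "x \<preceq> inv m'"
    using Mc(1) inv_le_inv_iff[of "inv x" m'] by simp
  then show ?thesis
    using lideal_convex[OF M_ideal m(1) Mc(3)[OF m(2)]] x m by blast
qed

section \<open>The real number cut out by an element\<close>

lemma unit_pow_cone:
  assumes "u [^] (k::int) \<in> cone"
  shows "0 \<le> k"
proof (rule ccontr)
  assume "\<not> 0 \<le> k"
  have "u \<in> cone"
    by (simp add: nonneg_cone u_nonneg)
  \<comment> \<open>For \<open>k < 0\<close> the exponent \<open>- k - 1\<close> is still
    nonnegative, and the product is exactly \<open>inv u\<close>.\<close>
  then have "u [^] k \<otimes> u [^] (- k - 1) \<in> cone"
    using \<open>\<not> 0 \<le> k\<close> by (intro cone_mult[OF assms] cone_pow) simp_all
  then have "inv u \<in> cone"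
    by (simp add: int_pow_mult[symmetric] int_pow_neg)
  then show False
    using cone_antisym[OF \<open>u \<in> cone\<close>] YG_unit[OF M] by simp
qed

text \<open>Scaling the two memberships by \<open>n'\<close> and \<open>n\<close> and adding them
  cancels \<open>x\<close> and leaves a multiple of \<open>u\<close> in the cone. In terms of
  fractions, lower ones never exceed upper ones.\<close>

lemma cut_le:
  assumes x: "x \<in> carrier G" and n: "0 < n" "0 < n'"
    and "x [^] n \<otimes> inv (u [^] m) \<in> cone" "u [^] m' \<otimes> inv (x [^] n') \<in> cone"
  shows "(m::int) * n' \<le> m' * (n::int)"
proof -
  have "(x [^] n \<otimes> inv (u [^] m)) [^] n' \<otimes> (u [^] m' \<otimes> inv (x [^] n')) [^] n \<in> cone"
    using assms(4,5) n by (intro cone_mult[OF cone_pow cone_pow]) simp_all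
  also have "(x [^] n \<otimes> inv (u [^] m)) [^] n' = x [^] (n * n') \<otimes> u [^] (- (m * n'))"
    using x by (simp add: int_pow_distrib int_pow_pow int_pow_neg[symmetric])
  also have "(u [^] m' \<otimes> inv (x [^] n')) [^] n = u [^] (m' * n) \<otimes> x [^] (- (n * n'))"
    using x by (simp add: int_pow_distrib int_pow_pow int_pow_neg[symmetric] mult.commute)
  also have "(x [^] (n * n') \<otimes> u [^] (- (m * n'))) \<otimes> (u [^] (m' * n) \<otimes> x [^] (- (n * n'))) =
      (x [^] (n * n') \<otimes> x [^] (- (n * n'))) \<otimes> (u [^] (m' * n) \<otimes> u [^] (- (m * n')))"
    using x by (simp add: m_ac)
  also have "\<dots> = u [^] (m' * n - m * n')"
    using x by (simp add: int_pow_mult[symmetric])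
  finally show ?thesis
    using unit_pow_cone by fastforce
qed

text \<open>A strong unit traps \<open>x\<close> between two multiples of \<open>u\<close>, so the
  set of lower fractions is nonempty and bounded and its \<open>Sup\<close> is meaningful. By
  \<open>cut_le\<close> every upper fraction bounds it.\<close>

lemma val_cut:
  assumes x: "x \<in> carrier G" and n: "0 < n"
  shows val_ge: "x [^] n \<otimes> inv (u [^] m) \<in> cone \<Longrightarrow> of_int (m::int) \<le> of_int n * val x"
    and val_le: "u [^] m \<otimes> inv (x [^] n) \<in> cone \<Longrightarrow> of_int (n::int) * val x \<le> of_int m"
proof -
  define S :: "real set" where
    "S = {of_int m / of_int n | m n :: int. 0 < n \<and> x [^] n \<otimes> inv (u [^] m) \<in> cone}"
  have v: "val x = Sup S"
    by (simp add: val_def S_def)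
  obtain k k' :: nat where k: "x \<preceq> u [^] k" "inv x \<preceq> u [^] k'"
    using u_strong[of x] u_strong[of "inv x"] x by auto
  have le: "s \<le> of_int m / of_int n"
    if "s \<in> S" "u [^] m \<otimes> inv (x [^] n) \<in> cone" "0 < n" for s m n
  proof -
    obtain i j :: int where s: "s = of_int i / of_int j" "0 < j" "x [^] j \<otimes> inv (u [^] i) \<in> cone"
      using \<open>s \<in> S\<close> unfolding S_def by blast
    then have "real_of_int (i * n) \<le> real_of_int (m * j)"
      using cut_le[OF x s(2) that(3) s(3) that(2)] by (simp only: of_int_le_iff)
    then show ?thesis
      unfolding s(1) using s(2) that(3) by (simp add: divide_simps mult.commute)
  qed
  have "\<one> \<preceq> u [^] k \<otimes> inv x"
    using k x le_iff_one_le[of x "u [^] k"] by simp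
  then have "u [^] (int k) \<otimes> inv (x [^] (1::int)) \<in> cone"
    using x by (intro nonneg_cone) (simp_all add: int_pow_int)
  then have bdd: "bdd_above S"
    using le[of _ "int k" 1] by (intro bdd_aboveI[of S "real k"]) simp
  have "\<one> \<preceq> x \<otimes> u [^] k'"
    using k x le_iff_one_le[of "inv x" "u [^] k'"] by (simp add: m_comm)
  then have "x [^] (1::int) \<otimes> inv (u [^] (- int k')) \<in> cone"
    using x by (intro nonneg_cone) (simp_all add: int_pow_int int_pow_neg)
  then have "S \<noteq> {}"
    unfolding S_def using zero_less_one by blast
  show "of_int m \<le> of_int n * val x" if "x [^] n \<otimes> inv (u [^] m) \<in> cone"
  proof -
    have "of_int m / of_int n \<in> S"
      using that n by (auto simp: S_def)
    then have "of_int m / of_int n \<le> val x"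
      unfolding v using bdd by (rule cSup_upper)
    then show ?thesis
      using n by (simp add: field_simps)
  qed
  show "of_int n * val x \<le> of_int m" if "u [^] m \<otimes> inv (x [^] n) \<in> cone"
  proof -
    have "val x \<le> of_int m / of_int n"
      unfolding v using \<open>S \<noteq> {}\<close> le that n by (intro cSup_least) auto
    then show ?thesis
      using n by (simp add: field_simps)
  qed
qed

text \<open>By totality a failure would put the opposite difference into the cone, and
  \<open>val_le\<close> would contradict the strict inequality.\<close>

lemma lower_cut:
  assumes x: "x \<in> carrier G" and n: "0 < n" and "of_int k < of_int n * val x"
  shows "x [^] n \<otimes> inv (u [^] (k::int)) \<in> cone"
proof (rule ccontr)
  assume "x [^] n \<otimes> inv (u [^] k) \<notin> cone"
  then have "inv (x [^] n \<otimes> inv (u [^] k)) \<in> cone"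
    using x by (intro cone_total) simp_all
  then have "u [^] k \<otimes> inv (x [^] n) \<in> cone"
    using x by (simp add: inv_mult m_comm)
  then show False
    using val_le[OF x n] assms(3) by fastforce
qed

lemma upper_cut:
  assumes x: "x \<in> carrier G" and n: "0 < n" and "of_int n * val x < of_int k"
  shows "u [^] (k::int) \<otimes> inv (x [^] n) \<in> cone"
proof (rule ccontr)
  assume "u [^] k \<otimes> inv (x [^] n) \<notin> cone"
  then have "inv (u [^] k \<otimes> inv (x [^] n)) \<in> cone"
    using x by (intro cone_total) simp_all
  then have "x [^] n \<otimes> inv (u [^] k) \<in> cone"
    using x by (simp add: inv_mult m_comm)
  then show False
    using val_ge[OF x n] assms(3) by fastforce
qed

text \<open>Rounding \<open>n * val x\<close> up or down to an integer yields a member of the cone,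
  whose image under \<open>h\<close> is nonnegative. So \<open>n * h x\<close> and
  \<open>n * val x\<close> differ by at most 1 for every \<open>n\<close>.\<close>

lemma val_unique:
  fixes h :: "'a \<Rightarrow> real"
  assumes add: "\<And>x y. x \<in> carrier G \<Longrightarrow> y \<in> carrier G \<Longrightarrow> h (x \<otimes> y) = h x + h y"
    and nonneg: "\<And>x. x \<in> cone \<Longrightarrow> 0 \<le> h x" and hu: "h u = 1" and x: "x \<in> carrier G"
  shows "h x = val x"
proof -
  have one: "h \<one> = 0"
    using add[of \<one> \<one>] by simp
  have inv: "h (inv y) = - h y" if "y \<in> carrier G" for y
    using add[of y "inv y"] that one by simp
  have natpow: "h (y [^] n) = real n * h y" if "y \<in> carrier G" for y and n :: nat
    by (induction n) (simp_all add: one add that algebra_simps)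
  have pow: "h (y [^] n) = of_int n * h y" if "y \<in> carrier G" for y and n :: int
    using that by (cases n rule: int_cases2) (simp_all add: int_pow_int int_pow_neg natpow inv)
  show ?thesis
  proof (rule antisym)
    show "h x \<le> val x"
    proof (rule real_le_if_multiples_le)
      fix n :: int assume n: "0 < n"
      \<comment> \<open>Floor plus one rather than ceiling: \<open>upper_cut\<close> needs
        strictness even when \<open>n * val x\<close> is an integer.\<close>
      define k where "k = \<lfloor>of_int n * val x\<rfloor> + 1"
      have "of_int n * val x < of_int k" "of_int k \<le> of_int n * val x + 1"
        unfolding k_def by linarith+
      moreover from nonneg[OF upper_cut[OF x n this(1)]] have "of_int n * h x \<le> of_int k"
        using x by (simp add: add inv pow hu)
      ultimately show "of_int n * h x \<le> of_int n * val x + 1"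
        by linarith
    qed
    show "val x \<le> h x"
    proof (rule real_le_if_multiples_le)
      fix n :: int assume n: "0 < n"
      define k where "k = \<lceil>of_int n * val x\<rceil> - 1"
      have "of_int k < of_int n * val x" "of_int n * val x \<le> of_int k + 1"
        unfolding k_def by linarith+
      moreover from nonneg[OF lower_cut[OF x n this(1)]] have "of_int k \<le> of_int n * h x"
        using x by (simp add: add inv pow hu)
      ultimately show "of_int n * val x \<le> of_int n * h x + 1"
        by linarith
    qed
  qed
qed

text \<open>Cuts of \<open>x\<close> and \<open>y\<close> with the same denominator \<open>n\<close>
  add up to a cut of \<open>x \<otimes> y\<close>. The two roundings cost at most 2, uniformly in
  \<open>n\<close>.\<close>

lemma val_mult:
  assumes x: "x \<in> carrier G" and y: "y \<in> carrier G"
  shows "val (x \<otimes> y) = val x + val y"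
proof (rule antisym)
  have pow: "(x \<otimes> y) [^] n \<otimes> inv (u [^] (k + l)) = (x [^] n \<otimes> inv (u [^] k)) \<otimes> (y [^] n \<otimes> inv (u [^] l))"
    for n k l :: int
    using x y by (simp add: int_pow_distrib int_pow_mult inv_mult m_ac)
  have pow': "u [^] (k + l) \<otimes> inv ((x \<otimes> y) [^] n) = (u [^] k \<otimes> inv (x [^] n)) \<otimes> (u [^] l \<otimes> inv (y [^] n))"
    for n k l :: int
    using x y by (simp add: int_pow_distrib int_pow_mult inv_mult m_ac)
  have xy: "x \<otimes> y \<in> carrier G"
    using x y by simp
  show "val x + val y \<le> val (x \<otimes> y)"
  proof (rule real_le_if_multiples_le)
    fix n :: int assume n: "0 < n"
    define k where "k = \<lceil>of_int n * val x\<rceil> - 1"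
    define l where "l = \<lceil>of_int n * val y\<rceil> - 1"
    have k: "of_int k < of_int n * val x" "of_int n * val x \<le> of_int k + 1"
      unfolding k_def by linarith+
    have l: "of_int l < of_int n * val y" "of_int n * val y \<le> of_int l + 1"
      unfolding l_def by linarith+
    have "of_int (k + l) \<le> of_int n * val (x \<otimes> y)"
      using cone_mult[OF lower_cut[OF x n k(1)] lower_cut[OF y n l(1)]]
      by (intro val_ge[OF xy n]) (simp add: pow)
    then show "of_int n * (val x + val y) \<le> of_int n * val (x \<otimes> y) + 2"
      using k l by (simp add: algebra_simps)
  qed
  show "val (x \<otimes> y) \<le> val x + val y"
  proof (rule real_le_if_multiples_le)
    fix n :: int assume n: "0 < n"
    define k where "k = \<lfloor>of_int n * val x\<rfloor> + 1"
    define l where "l = \<lfloor>of_int n * val y\<rfloor> + 1"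
    have k: "of_int n * val x < of_int k" "of_int k \<le> of_int n * val x + 1"
      unfolding k_def by linarith+
    have l: "of_int n * val y < of_int l" "of_int l \<le> of_int n * val y + 1"
      unfolding l_def by linarith+
    have "of_int n * val (x \<otimes> y) \<le> of_int (k + l)"
      using cone_mult[OF upper_cut[OF x n k(1)] upper_cut[OF y n l(1)]]
      by (intro val_le[OF xy n]) (simp add: pow')
    then show "of_int n * val (x \<otimes> y) \<le> of_int n * (val x + val y) + 2"
      using k l by (simp add: algebra_simps)
  qed
qed

lemma val_one: "val \<one> = 0"
  using val_mult[of \<one> \<one>] by simp

lemma val_inv: "x \<in> carrier G \<Longrightarrow> val (inv x) = - val x"
  using val_mult[of x "inv x"] by (simp add: val_one)

lemma val_unit: "val u = 1"
  using val_ge[of u 1 1] val_le[of u 1 1] by (simp add: M_cone Mc)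

lemma val_cone_nonneg: "x \<in> cone \<Longrightarrow> 0 \<le> val x"
  using val_ge[of x 1 0] cone_closed[of x] by simp

lemma val_M: "x \<in> M \<Longrightarrow> val x = 0"
  using val_cone_nonneg[of x] val_cone_nonneg[of "inv x"] Mc(1,3)[of x] M_cone
  by (simp add: val_inv)

text \<open>Nothing outside \<open>M\<close> is infinitesimal modulo \<open>M\<close>: shifting
  \<open>x\<close> by an element of \<open>M\<close> gives some \<open>y \<ge> 0\<close> in
  \<open>G\<close>, and \<open>YG_cofinal\<close> makes a multiple of \<open>y\<close> exceed
  \<open>u\<close>, so \<open>1 \<le> n * val x\<close>.\<close>

lemma val_cone_pos:
  assumes "x \<in> cone" "x \<notin> M"
  shows "0 < val x"
proof -
  have x: "x \<in> carrier G"
    using assms by blast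
  obtain m0 where m0: "m0 \<in> M" "m0 \<preceq> x"
    using assms unfolding cone_def by blast
  define y where "y = x \<otimes> inv m0"
  have m0c: "m0 \<in> carrier G" using m0 Mc by blast
  then have y: "y \<in> carrier G" "\<one> \<preceq> y" "x = y \<otimes> m0"
    using x m0 le_iff_one_le[of m0 x] by (simp_all add: y_def m_assoc)
  then have "y \<notin> M"
    using assms(2) m0 Mc(4) by blast
  then obtain m n where m: "m \<in> M" "u \<preceq> m \<otimes> y [^] (n::nat)"
    using YG_cofinal[OF M y(1,2)] by blast
  have mc: "m \<in> carrier G" using m Mc by blast
  have "m \<otimes> y [^] n \<otimes> inv u \<in> cone"
    using m mc y le_iff_one_le[of u "m \<otimes> y [^] n"] by (intro nonneg_cone) simp_all
  then have "0 \<le> val (m \<otimes> y [^] n \<otimes> inv u)"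
    by (rule val_cone_nonneg)
  moreover have "val (y [^] n) = real n * val y"
    by (induction n) (simp_all add: val_one val_mult y(1) algebra_simps)
  moreover have "val y = val x"
    using y m0 m0c by (simp add: val_mult val_M)
  ultimately have "1 \<le> real n * val x"
    using m mc y by (simp add: val_mult val_inv val_unit val_M)
  then show ?thesis
    using val_cone_nonneg[OF assms(1)] by (cases "val x = 0") auto
qed

lemma val_eq_0_iff:
  assumes x: "x \<in> carrier G"
  shows "val x = 0 \<longleftrightarrow> x \<in> M"
proof -
  have "x \<in> M" if "val x = 0"
    using that val_cone_pos[of x] val_cone_pos[of "inv x"] cone_total[OF x] x Mc(3)[of "inv x"]
    by (auto simp: val_inv)
  then show ?thesis using val_M by blast
qed

lemma val_le_iff:
  assumes x: "x \<in> carrier G" and y: "y \<in> carrier G"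
  shows "val x \<le> val y \<longleftrightarrow> y \<otimes> inv x \<in> cone"
proof -
  have d: "val (y \<otimes> inv x) = val y - val x"
    using x y by (simp add: val_mult val_inv)
  have "y \<otimes> inv x \<in> cone" if "val x \<le> val y"
  proof (rule ccontr)
    assume *: "y \<otimes> inv x \<notin> cone"
    then have "inv (y \<otimes> inv x) \<in> cone"
      using x y by (intro cone_total) simp_all
    then have "val y \<le> val x"
      using val_cone_nonneg[of "inv (y \<otimes> inv x)"] d x y by (simp add: val_inv del: inv_mult_group)
    then show False
      using * that d M_cone[of "y \<otimes> inv x"] val_eq_0_iff[of "y \<otimes> inv x"] x y by simp
  qed
  then show ?thesis
    using val_cone_nonneg d by fastforce
qed

lemma val_mono: "x \<preceq> y \<Longrightarrow> x \<in> carrier G \<Longrightarrow> y \<in> carrier G \<Longrightarrow> val x \<le> val y"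
  by (simp add: val_le_iff nonneg_cone le_iff_one_le[symmetric])

text \<open>If \<open>val b \<le> val a\<close>, then \<open>b\<close> lies below \<open>a\<close>
  up to some \<open>m\<close> in \<open>M\<close>. This \<open>m\<close> bounds the infimum from
  below by a translate of \<open>b\<close> and the supremum from above by a translate of
  \<open>a\<close>, and \<open>val\<close> does not see it.\<close>

lemma val_sup_inf:
  assumes x: "x \<in> carrier G" and y: "y \<in> carrier G"
  shows "val (lsup G x y) = max (val x) (val y)" "val (linf G x y) = min (val x) (val y)"
proof -
  have *: "val (lsup G a b) \<le> val a \<and> val b \<le> val (linf G a b)"
    if ab: "a \<in> carrier G" "b \<in> carrier G" "val b \<le> val a" for a b
  proof -
    have "a \<otimes> inv b \<in> cone"
      using ab by (simp add: val_le_iff[symmetric])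
    then obtain m0 where m0: "m0 \<in> M" "m0 \<preceq> a \<otimes> inv b"
      unfolding cone_def by blast
    \<comment> \<open>Truncation at \<open>\<one>\<close> keeps \<open>m\<close> in \<open>M\<close>
      and makes \<open>m \<otimes> b \<preceq> b\<close> and
      \<open>m \<otimes> a \<preceq> a\<close> hold too.\<close>
    define m where "m = linf G m0 \<one>"
    have m0c: "m0 \<in> carrier G" using m0 Mc by blast
    have mM: "m \<in> M" using m0 Mc by (simp add: m_def)
    have m: "m \<in> carrier G" "m \<preceq> \<one>" "m \<preceq> a \<otimes> inv b"
      using m0 m0c ab inf_le1[of m0 \<one>] inf_le2[of m0 \<one>] le_trans[of m m0 "a \<otimes> inv b"]
      by (simp_all add: m_def)
    have mb: "m \<otimes> b \<preceq> a" "m \<otimes> b \<preceq> b"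
      using m ab le_mult_iff[of m a "inv b"] mult_right_mono[of m \<one> b] by simp_all
    have 1: "m \<otimes> b \<preceq> linf G a b"
      using mb m ab by (intro inf_greatest) simp_all
    have "m \<otimes> a \<preceq> a"
      using m ab mult_right_mono[of m \<one> a] by simp
    then have "b \<preceq> inv m \<otimes> a" "a \<preceq> inv m \<otimes> a"
      using mb m ab le_mult_iff'[of b a "inv m"] le_mult_iff'[of a a "inv m"]
      by (simp_all add: m_comm)
    then have 2: "lsup G a b \<preceq> inv m \<otimes> a"
      using m ab by (intro sup_least) simp_all
    show ?thesis
      using val_mono[OF 1] val_mono[OF 2] m mM ab by (simp add: val_mult val_inv val_M)
  qed
  have c: "lsup G y x = lsup G x y" "linf G y x = linf G x y"
    using x y by (auto intro!: le_antisym sup_least sup_ge1 sup_ge2 simp: inf_commute)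
  have "val x \<le> val (lsup G x y)" "val y \<le> val (lsup G x y)"
    "val (linf G x y) \<le> val x" "val (linf G x y) \<le> val y"
    using x y by (simp_all add: val_mono sup_ge1 sup_ge2 inf_le1 inf_le2)
  then show "val (lsup G x y) = max (val x) (val y)" "val (linf G x y) = min (val x) (val y)"
    using *[of x y] *[of y x] x y c by (auto simp: max_def min_def)
qed

end

section \<open>The Yosida representation\<close>

lemma comm_group_real_lgroup: "comm_group real_lgroup"
  by (rule comm_groupI) (auto simp: real_lgroup_def intro: exI[of _ "- x" for x])

lemma real_lgroup_simps [simp]:
  "carrier real_lgroup = UNIV" "x \<otimes>\<^bsub>real_lgroup\<^esub> y = x + y" "\<one>\<^bsub>real_lgroup\<^esub> = 0"
  "lle real_lgroup x y \<longleftrightarrow> x \<le> y"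
  by (simp_all add: real_lgroup_def)

lemma inv_real_lgroup [simp]: "inv\<^bsub>real_lgroup\<^esub> x = - x"
proof -
  interpret comm_group real_lgroup by (rule comm_group_real_lgroup)
  show ?thesis by (rule inv_equality) simp_all
qed

lemma pow_real_lgroup [simp]: "x [^]\<^bsub>real_lgroup\<^esub> (n::nat) = real n * x"
  by (induction n) (simp_all add: algebra_simps)

lemma lattice_real_lgroup: "lattice (lorder real_lgroup)"
  unfolding lattice_lorder_iff
proof (intro conjI ballI)
  fix x y :: real
  show "\<exists>s. least (lorder real_lgroup) s (Upper (lorder real_lgroup) {x, y})"
    by (rule exI[of _ "max x y"]) (simp add: least_Upper_lorder_iff)
  show "\<exists>s. greatest (lorder real_lgroup) s (Lower (lorder real_lgroup) {x, y})"
    by (rule exI[of _ "min x y"]) (simp add: greatest_Lower_lorder_iff)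
qed auto

lemma lsup_real_lgroup [simp]: "lsup real_lgroup x y = max x y"
  and linf_real_lgroup [simp]: "linf real_lgroup x y = min x y"
  using lsup_props[OF lattice_real_lgroup, of x y] linf_props[OF lattice_real_lgroup, of x y]
  by (auto intro!: antisym)

lemma Wstar_real_lgroup: "Wstar real_lgroup 1"
proof -
  have "archimedean real_lgroup"
    unfolding archimedean_def
  proof (intro ballI impI)
    fix a b :: real
    assume *: "lle real_lgroup \<one>\<^bsub>real_lgroup\<^esub> a \<and> (\<forall>n::nat. lle real_lgroup (a [^]\<^bsub>real_lgroup\<^esub> n) b)"
    show "a = \<one>\<^bsub>real_lgroup\<^esub>"
    proof (rule ccontr)
      assume "a \<noteq> \<one>\<^bsub>real_lgroup\<^esub>"
      then obtain n :: nat where "b < real n * a"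
        using * reals_Archimedean3[of a] by auto
      then show False
        using * by (auto simp: not_le[symmetric])
    qed
  qed
  moreover have "strong_unit real_lgroup 1"
  proof -
    have "\<exists>n>0. max x (- x) \<le> real n" for x :: real
    proof -
      obtain n where "max x (- x) \<le> real n"
        using real_arch_simple by blast
      \<comment> \<open>\<open>principal_lideal\<close> demands a positive multiplier, while the
        bound \<open>n\<close> may be 0.\<close>
      then show ?thesis
        by (intro exI[of _ "Suc n"]) simp
    qed
    then show ?thesis
      by (auto simp: strong_unit_def principal_lideal_def labs_def)
  qed
  ultimately show ?thesis
    by (simp add: Wstar_def abelian_lgroup_def comm_group_real_lgroup lattice_real_lgroup)
qed

section \<open>The quotient \<open>G/M\<close> and its embedding into the reals\<close>

context max_lideal
begin

lemma mem_coset_iff: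
  assumes x: "x \<in> carrier G"
  shows "y \<in> M #> x \<longleftrightarrow> y \<in> carrier G \<and> val y = val x"
proof
  assume "y \<in> M #> x"
  then obtain m where m: "m \<in> M" "y = m \<otimes> x"
    unfolding r_coset_def by blast
  then show "y \<in> carrier G \<and> val y = val x"
    using x Mc(1)[of m] by (simp add: val_mult val_M)
next
  assume y: "y \<in> carrier G \<and> val y = val x"
  then have "y \<otimes> inv x \<in> M"
    using x by (simp add: val_eq_0_iff[symmetric] val_mult val_inv)
  moreover have "y = (y \<otimes> inv x) \<otimes> x"
    using x y by (simp add: m_assoc)
  ultimately show "y \<in> M #> x"
    unfolding r_coset_def by blast
qed

text \<open>The order of \<open>lquot\<close> asks only for some comparable representatives; in the
  coset of \<open>x\<close>, the element \<open>m \<otimes> x\<close> is one that lies below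
  \<open>y\<close>.\<close>

lemma lle_lquot_iff:
  assumes x: "x \<in> carrier G" and y: "y \<in> carrier G"
  shows "lle (lquot G M) (M #> x) (M #> y) \<longleftrightarrow> val x \<le> val y"
proof
  assume "lle (lquot G M) (M #> x) (M #> y)"
  then obtain a b where "a \<in> carrier G" "val a = val x" "b \<in> carrier G" "val b = val y" "a \<preceq> b"
    by (auto simp: lquot_def mem_coset_iff x y)
  then show "val x \<le> val y"
    using val_mono[of a b] by simp
next
  assume "val x \<le> val y"
  then obtain m where m: "m \<in> M" "m \<preceq> y \<otimes> inv x"
    using val_le_iff[OF x y] unfolding cone_def by blast
  have "m \<otimes> x \<preceq> y"
    using m x y Mc(1)[of m] le_mult_iff[of m y "inv x"] by simp
  moreover have "m \<otimes> x \<in> M #> x" "y \<in> M #> y"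
    using m x y Mc(1)[of m] by (simp_all add: mem_coset_iff val_mult val_M)
  ultimately show "lle (lquot G M) (M #> x) (M #> y)"
    unfolding lquot_def by auto
qed

lemma carrier_lquot: "carrier (lquot G M) = (\<lambda>x. M #> x) ` carrier G"
  by (simp add: lquot_def carrier_FactGroup)

lemma mult_lquot:
  "x \<in> carrier G \<Longrightarrow> y \<in> carrier G \<Longrightarrow> (M #> x) \<otimes>\<^bsub>lquot G M\<^esub> (M #> y) = M #> (x \<otimes> y)"
proof -
  interpret normal M G
    using M_ideal unfolding lideal_def by (intro subgroup_imp_normal) simp
  show "x \<in> carrier G \<Longrightarrow> y \<in> carrier G \<Longrightarrow> (M #> x) \<otimes>\<^bsub>lquot G M\<^esub> (M #> y) = M #> (x \<otimes> y)"
    by (simp add: lquot_def rcos_sum)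
qed

lemma one_lquot: "\<one>\<^bsub>lquot G M\<^esub> = M #> \<one>"
  using Mc(1) by (simp add: lquot_def coset_mult_one subsetI)

text \<open>\<open>val\<close> is constant on cosets and separates them, so
  \<open>Wstar_embedding\<close> transports lattice laws, Archimedean property and strong unit from
  the reals back to the quotient.\<close>

lemma lquot_embedding:
  obtains \<phi> where "\<phi> \<in> lgroup_hom (lquot G M) real_lgroup" "inj_on \<phi> (carrier (lquot G M))"
    "\<And>x. x \<in> carrier G \<Longrightarrow> \<phi> (M #> x) = val x" "Wstar (lquot G M) (M #> u)"
proof -
  define \<phi> where "\<phi> A = the_elem (val ` A)" for A
  have phi: "\<phi> (M #> x) = val x" if "x \<in> carrier G" for x
  proof -
    have "val ` (M #> x) = {val x}"
      using that mem_coset_iff[OF that] by auto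
    then show ?thesis by (simp add: \<phi>_def)
  qed
  have inj: "inj_on \<phi> (carrier (lquot G M))"
  proof (rule inj_onI)
    fix A B assume A: "A \<in> carrier (lquot G M)" and B: "B \<in> carrier (lquot G M)" and eq: "\<phi> A = \<phi> B"
    obtain x y where xy: "x \<in> carrier G" "y \<in> carrier G" "A = M #> x" "B = M #> y"
      using A B unfolding carrier_lquot by blast
    then have "val x = val y"
      using eq by (simp add: phi)
    then show "A = B"
      using xy by (auto simp: mem_coset_iff)
  qed
  \<comment> \<open>In a total order, maximum and minimum are one of the two arguments, so the image
    is closed under them.\<close>
  have total: "\<exists>C\<in>carrier (lquot G M). \<phi> C = max (\<phi> A) (\<phi> B)"
    "\<exists>C\<in>carrier (lquot G M). \<phi> C = min (\<phi> A) (\<phi> B)"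
    if "A \<in> carrier (lquot G M)" "B \<in> carrier (lquot G M)" for A B
    using that unfolding max_def min_def by auto
  have hom: "\<phi> \<in> hom (lquot G M) real_lgroup"
  proof (rule homI)
    fix A B assume "A \<in> carrier (lquot G M)" "B \<in> carrier (lquot G M)"
    then obtain x y where xy: "x \<in> carrier G" "y \<in> carrier G" "A = M #> x" "B = M #> y"
      unfolding carrier_lquot by blast
    show "\<phi> (A \<otimes>\<^bsub>lquot G M\<^esub> B) = \<phi> A \<otimes>\<^bsub>real_lgroup\<^esub> \<phi> B"
      unfolding xy mult_lquot[OF xy(1,2)] using xy(1,2) by (simp add: phi val_mult)
  qed simp
  have inv: "\<exists>B\<in>carrier (lquot G M). \<phi> B = inv\<^bsub>real_lgroup\<^esub> \<phi> A" if A: "A \<in> carrier (lquot G M)" for A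
  proof -
    obtain x where "x \<in> carrier G" "A = M #> x"
      using A unfolding carrier_lquot by blast
    then show ?thesis
      unfolding carrier_lquot by (intro bexI[of _ "M #> inv x"]) (simp_all add: phi val_inv)
  qed
  have mult: "A \<otimes>\<^bsub>lquot G M\<^esub> B \<in> carrier (lquot G M)"
    if AB: "A \<in> carrier (lquot G M)" "B \<in> carrier (lquot G M)" for A B
  proof -
    obtain x y where "x \<in> carrier G" "y \<in> carrier G" "A = M #> x" "B = M #> y"
      using AB unfolding carrier_lquot by blast
    then show ?thesis
      by (simp add: carrier_lquot mult_lquot)
  qed
  have le: "lle (lquot G M) A B \<longleftrightarrow> lle real_lgroup (\<phi> A) (\<phi> B)"
    if AB: "A \<in> carrier (lquot G M)" "B \<in> carrier (lquot G M)" for A B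
  proof -
    obtain x y where "x \<in> carrier G" "y \<in> carrier G" "A = M #> x" "B = M #> y"
      using AB unfolding carrier_lquot by blast
    then show ?thesis
      by (simp add: lle_lquot_iff phi)
  qed
  have one: "\<one>\<^bsub>lquot G M\<^esub> \<in> carrier (lquot G M)" "\<phi> \<one>\<^bsub>lquot G M\<^esub> = \<one>\<^bsub>real_lgroup\<^esub>"
    by (simp_all add: carrier_lquot one_lquot phi val_one)
  have unit: "M #> u \<in> carrier (lquot G M)" "\<phi> (M #> u) = 1"
    by (simp_all add: carrier_lquot phi val_unit)
  have "Wstar (lquot G M) (M #> u) \<and> \<phi> \<in> lgroup_hom (lquot G M) real_lgroup"
    by (rule Wstar_embedding[OF Wstar_real_lgroup inj hom mult one inv le total[folded lsup_real_lgroup linf_real_lgroup] unit])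
  then show thesis
    using that inj phi by blast
qed

text \<open>Preserving infima makes \<open>\<psi>\<close> monotone, so its composition with the
  coset map satisfies the hypotheses of \<open>val_unique\<close>.\<close>

lemma lquot_hom_eq_val:
  assumes psi: "\<psi> \<in> lgroup_hom (lquot G M) real_lgroup" "\<psi> (M #> u) = 1" and x: "x \<in> carrier G"
  shows "\<psi> (M #> x) = val x"
proof (rule val_unique[where h = "\<lambda>x. \<psi> (M #> x)", OF _ _ psi(2) x])
  show add: "\<psi> (M #> (x \<otimes> y)) = \<psi> (M #> x) + \<psi> (M #> y)" if "x \<in> carrier G" "y \<in> carrier G" for x y
    using psi(1) that by (auto simp: lgroup_hom_def hom_def carrier_lquot mult_lquot[symmetric])
  fix x assume x: "x \<in> cone"
  then have xc: "x \<in> carrier G" by blast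
  obtain \<phi> where "Wstar (lquot G M) (M #> u)"
    using lquot_embedding by blast
  \<comment> \<open>\<open>linf\<close> is a choice among greatest lower bounds; antisymmetry
    identifies it below with the coset \<open>M #> \<one>\<close>.\<close>
  then have lat: "lattice (lorder (lquot G M))"
    by (simp add: Wstar_def abelian_lgroup_def)
  have c: "M #> \<one> \<in> carrier (lquot G M)" "M #> x \<in> carrier (lquot G M)"
    using xc unfolding carrier_lquot by blast+
  have "lle (lquot G M) (M #> \<one>) (M #> x)"
    using x xc by (simp add: lle_lquot_iff val_one val_cone_nonneg)
  then have "linf (lquot G M) (M #> \<one>) (M #> x) = M #> \<one>"
    using c by (intro lattice_antisym[OF lat] linf_props[OF lat] lattice_refl[OF lat]) simp_all
  moreover have "\<psi> (linf (lquot G M) (M #> \<one>) (M #> x)) = min (\<psi> (M #> \<one>)) (\<psi> (M #> x))"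
    using psi(1) c by (simp add: lgroup_hom_def)
  moreover have "\<psi> (M #> \<one>) = 0"
    using add[of \<one> \<one>] by simp
  ultimately show "0 \<le> \<psi> (M #> x)"
    by (simp add: min_def split: if_splits)
qed

lemma yosida_eq_val:
  assumes x: "x \<in> carrier G"
  shows "yosida G u x M = val x"
  unfolding yosida_def
proof (rule the_equality)
  obtain \<phi> where "\<phi> \<in> lgroup_hom (lquot G M) real_lgroup" "inj_on \<phi> (carrier (lquot G M))"
    "\<And>x. x \<in> carrier G \<Longrightarrow> \<phi> (M #> x) = val x"
    using lquot_embedding by blast
  then show "\<exists>\<phi>. \<phi> \<in> lgroup_hom (lquot G M) real_lgroup \<and> inj_on \<phi> (carrier (lquot G M)) \<and>
      \<phi> (M #> u) = 1 \<and> val x = \<phi> (M #> x)"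
    using x val_unit by (intro exI[of _ \<phi>]) simp
qed (use x lquot_hom_eq_val in blast)

lemma Wstar_kernel_max_lideal:
  assumes "Wstar G u"
  shows "Wstar_kernel G u M"
proof -
  have "Wstar_morphism G u real_lgroup 1 val"
    by (auto simp: Wstar_morphism_def lgroup_hom_def hom_def val_mult val_sup_inf val_unit)
  then have "Wstar_kernel G u (kernel G real_lgroup val)"
    by (rule Wstar_kernelI[OF assms Wstar_real_lgroup])
  also have "kernel G real_lgroup val = M"
    using Mc(1) by (auto simp: kernel_def val_eq_0_iff)
  finally show ?thesis .
qed

end

section \<open>Separation by maximal ideals, and cozero sets\<close>

locale wstar = ab_lgroup G for G :: "'a lgroup" (structure) +
  fixes u :: 'a
  assumes W: "Wstar G u"
begin

lemma u_closed [simp, intro]: "u \<in> carrier G"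
  and u_nonneg: "\<one> \<preceq> u"
  using W by (simp_all add: Wstar_def strong_unit_def)

lemma u_strong:
  assumes "x \<in> carrier G"
  shows "\<exists>n::nat. x \<preceq> u [^] n"
proof -
  have "x \<in> principal_lideal G u"
    using W assms by (simp add: Wstar_def strong_unit_def)
  then obtain n :: nat where "labs G x \<preceq> u [^] n"
    by (auto simp: principal_lideal_def abs_of_nonneg u_nonneg)
  then have "x \<preceq> u [^] n"
    using assms le_trans[OF le_abs[of x]] by simp
  then show ?thesis by blast
qed

lemma max_lideal: "M \<in> YG G u \<Longrightarrow> max_lideal G u M"
  by unfold_locales (simp_all add: u_nonneg u_strong)

lemma yosida_eq_0_iff:
  "M \<in> YG G u \<Longrightarrow> g \<in> carrier G \<Longrightarrow> yosida G u g M = 0 \<longleftrightarrow> g \<in> M"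
  using max_lideal.yosida_eq_val[OF max_lideal] max_lideal.val_eq_0_iff[OF max_lideal] by simp

lemma mem_coz_iff: "g \<in> carrier G \<Longrightarrow> M \<in> coz G u g \<longleftrightarrow> M \<in> YG G u \<and> g \<notin> M"
  by (auto simp: coz_def yosida_eq_0_iff)

lemma mem_Zset_iff: "g \<in> carrier G \<Longrightarrow> M \<in> Zset G u g \<longleftrightarrow> M \<in> YG G u \<and> g \<in> M"
  by (auto simp: Zset_def mem_coz_iff)

lemma Iset_eq: "S \<subseteq> YG G u \<Longrightarrow> Iset G u S = {g \<in> carrier G. \<forall>M\<in>S. g \<in> M}"
  by (auto simp: Iset_def mem_Zset_iff subset_iff)

lemma Mpoint_eq: "M \<in> YG G u \<Longrightarrow> Mpoint G u M = Iset G u {M}"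
  by (auto simp: Mpoint_def yosida_eq_0_iff Iset_eq)

lemma coz_subset: "coz G u g \<subseteq> YG G u"
  by (auto simp: coz_def)

lemma coz_abs: "g \<in> carrier G \<Longrightarrow> coz G u (labs G g) = coz G u g"
  using lideal_abs_iff[OF YG_lideal] by (auto simp: mem_coz_iff)

text \<open>Some multiple of \<open>u\<close> dominates \<open>x\<close> and is still disjoint from
  it, so \<open>x\<close> lies below an infimum that is 0.\<close>

lemma disjoint_unit:
  assumes x: "x \<in> carrier G" "\<one> \<preceq> x" and "linf G x u = \<one>"
  shows "x = \<one>"
proof -
  obtain n :: nat where n: "x \<preceq> u [^] n"
    using u_strong x by blast
  have "linf G x (u [^] n) = \<one>"
    using assms by (intro inf_pow_eq_one u_nonneg) simp_all
  moreover have "x \<preceq> linf G x (u [^] n)"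
    using x n by (intro inf_greatest) simp_all
  ultimately show ?thesis
    using x by (intro le_antisym) simp_all
qed

text \<open>Otherwise the ideal generated by \<open>v\<close> would omit \<open>u\<close> and extend
  to a point of \<open>YG G u\<close> containing \<open>v\<close>.\<close>

lemma no_YG_unit_le_pow:
  assumes v: "v \<in> carrier G" "\<one> \<preceq> v" and "\<And>M. M \<in> YG G u \<Longrightarrow> v \<notin> M"
  shows "\<exists>n::nat. u \<preceq> v [^] n"
proof -
  note adj = adjoin_lideal[OF lideal_triv v]
  have "u \<in> adjoin {\<one>} v"
  proof (rule ccontr)
    assume "u \<notin> adjoin {\<one>} v"
    then obtain M where "M \<in> YG G u" "adjoin {\<one>} v \<subseteq> M"
      using exists_YG[OF adj(1)] by blast
    then show False
      using assms(3) adj(3) by blast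
  qed
  then show ?thesis
    using v by (auto simp: adjoin_def)
qed

text \<open>If \<open>d = na - u\<close> is not \<open>\<le> 0\<close>, then the negative part of \<open>d\<close> is disjoint from \<open>d\<^sup>+ \<noteq> 0\<close>, so it is no
  strong unit and lies in some \<open>M\<close>; modulo that \<open>M\<close>, \<open>na \<ge> u\<close>, whence \<open>a\<close> is not in \<open>M\<close>.\<close>

lemma YG_separates:
  assumes g: "g \<in> carrier G" and all: "\<And>M. M \<in> YG G u \<Longrightarrow> g \<in> M"
  shows "g = \<one>"
proof -
  define a where "a = labs G g"
  have a: "a \<in> carrier G" "\<one> \<preceq> a"
    using g by (simp_all add: a_def abs_nonneg)
  have "a [^] n \<preceq> u" for n :: nat
  proof -
    define d where "d = a [^] n \<otimes> inv u"
    define b where "b = ppart (inv d)"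
    have d: "d \<in> carrier G" and b: "b \<in> carrier G" "\<one> \<preceq> b"
      using a by (simp_all add: d_def b_def ppart_nonneg)
    have "b \<notin> M" if M: "M \<in> YG G u" for M
    proof
      assume "b \<in> M"
      note I = YG_lideal[OF M]
      have "a [^] n \<in> M"
        using all[OF M] g by (simp add: a_def lideal_closed[OF I] lideal_abs_iff[OF I])
      then have "a [^] n \<otimes> b \<in> M"
        using \<open>b \<in> M\<close> by (rule lideal_closed[OF I])
      moreover have "u \<preceq> a [^] n \<otimes> b"
      proof -
        have "u = a [^] n \<otimes> inv d"
          using a by (simp add: d_def inv_mult m_assoc[symmetric])
        also have "\<dots> \<preceq> a [^] n \<otimes> b"
          using a d b by (intro mult_left_mono) (simp_all add: b_def le_ppart)
        finally show ?thesis .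
      qed
      ultimately have "u \<in> M"
        using lideal_convex[OF I lideal_closed(2)[OF I]] u_nonneg by blast
      then show False
        using YG_unit[OF M] by simp
    qed
    then obtain k :: nat where k: "u \<preceq> b [^] k"
      using no_YG_unit_le_pow b by blast
    have "linf G (ppart d) (b [^] k) = \<one>"
      using d b by (intro inf_pow_eq_one) (simp_all add: b_def inf_ppart_inv ppart_nonneg)
    then have "linf G (b [^] k) (ppart d) = \<one>"
      using d b by (subst inf_commute) simp_all
    then have "linf G u (ppart d) = \<one>"
      using u_nonneg k by (rule inf_eq_one_mono) (use d b in \<open>simp_all add: ppart_nonneg\<close>)
    then have "linf G (ppart d) u = \<one>"
      using d by (subst inf_commute) simp_all
    then have "ppart d = \<one>"
      by (rule disjoint_unit[rotated 2]) (use d in \<open>simp_all add: ppart_nonneg\<close>)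
    then have "d \<preceq> \<one>"
      using d by (simp add: ppart_eq_one_iff)
    then show ?thesis
      using a le_mult_iff[of "a [^] n" \<one> u] by (simp add: d_def)
  qed
  then have "a = \<one>"
    using W a u_closed unfolding Wstar_def archimedean_def by blast
  then show ?thesis
    using g by (simp add: a_def abs_eq_one)
qed

text \<open>Subtracting the infimum \<open>d\<close> makes the two elements disjoint, so
  \<open>YG_prime\<close> puts one difference into \<open>M\<close>; adding back \<open>d\<close>,
  itself in \<open>M\<close>, recovers \<open>a\<close> or \<open>b\<close>.\<close>

lemma coz_inf:
  assumes a: "a \<in> carrier G" "\<one> \<preceq> a" and b: "b \<in> carrier G" "\<one> \<preceq> b"
  shows "coz G u (linf G a b) = coz G u a \<inter> coz G u b"
proof -
  define d where "d = linf G a b"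
  have d: "d \<in> carrier G" "\<one> \<preceq> d" "d \<preceq> a" "d \<preceq> b"
    using a b by (simp_all add: d_def inf_greatest inf_le1 inf_le2)
  have "d \<in> M \<longleftrightarrow> a \<in> M \<or> b \<in> M" if M: "M \<in> YG G u" for M
  proof
    note I = YG_lideal[OF M]
    assume "d \<in> M"
    define e where "e = linf G (a \<otimes> inv d) (b \<otimes> inv d)"
    have e: "e \<in> carrier G" "e \<preceq> a \<otimes> inv d" "e \<preceq> b \<otimes> inv d"
      using a b d by (simp_all add: e_def inf_le1 inf_le2)
    have nonneg: "\<one> \<preceq> a \<otimes> inv d" "\<one> \<preceq> b \<otimes> inv d"
      using a b d le_iff_one_le[of d a] le_iff_one_le[of d b] by simp_all
    have "e \<otimes> d \<preceq> d"
      unfolding d_def using a b d e le_mult_iff[of e a "inv d"] le_mult_iff[of e b "inv d"]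
      by (intro inf_greatest) (simp_all add: d_def)
    then have "e \<preceq> \<one>"
      using d e le_mult_iff[of e d "inv d"] by simp
    then have "e = \<one>"
      using a b d nonneg by (intro le_antisym) (simp_all add: e_def inf_greatest)
    then have "a \<otimes> inv d \<in> M \<or> b \<otimes> inv d \<in> M"
      using a b d nonneg by (intro YG_prime[OF M]) (simp_all add: e_def u_nonneg)
    then have "a \<otimes> inv d \<otimes> d \<in> M \<or> b \<otimes> inv d \<otimes> d \<in> M"
      using \<open>d \<in> M\<close> lideal_closed(4)[OF I] by blast
    then show "a \<in> M \<or> b \<in> M"
      using a b d by (simp add: m_assoc)
  next
    assume "a \<in> M \<or> b \<in> M"
    then show "d \<in> M"
      using lideal_convex[OF YG_lideal[OF M] lideal_closed(2)[OF YG_lideal[OF M]]] d by blast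
  qed
  then show ?thesis
    using a b d by (auto simp: mem_coz_iff d_def[symmetric])
qed

text \<open>The intersection is the cozero set of the infimum, and by \<open>YG_separates\<close>
  only \<open>\<one>\<close> has an empty cozero set.\<close>

lemma disjoint_iff_coz:
  assumes f: "f \<in> carrier G" and g: "g \<in> carrier G"
  shows "linf G (labs G f) (labs G g) = \<one> \<longleftrightarrow> coz G u f \<inter> coz G u g = {}"
proof -
  have c: "linf G (labs G f) (labs G g) \<in> carrier G"
    using f g by simp
  have "coz G u f \<inter> coz G u g = coz G u (linf G (labs G f) (labs G g))"
    using f g by (simp add: coz_inf abs_nonneg coz_abs)
  also have "\<dots> = {} \<longleftrightarrow> linf G (labs G f) (labs G g) = \<one>"
    using YG_separates[OF c] lideal_closed(2)[OF YG_lideal] mem_coz_iff[OF c] by fastforce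
  finally show ?thesis by simp
qed

lemma mem_polar_iff:
  "g \<in> carrier G \<Longrightarrow> f \<in> polar G g \<longleftrightarrow> f \<in> carrier G \<and> coz G u f \<inter> coz G u g = {}"
  using disjoint_iff_coz by (auto simp: polar_def)

section \<open>The hull-kernel topology and bipolars\<close>

lemma openin_coz: "g \<in> carrier G \<Longrightarrow> openin (YG_top G u) (coz G u g)"
  unfolding YG_top_def
  by (rule topology_generated_by_Basis, rule CollectI, rule exI[of _ "{g}"])
    (auto simp: mem_coz_iff)

text \<open>A generated topology lives on the union of its generators. The single set
  \<open>coz G u u\<close> already exhausts \<open>YG G u\<close>, since no point contains
  \<open>u\<close>.\<close>

lemma topspace_YG_top [simp]: "topspace (YG_top G u) = YG G u"
proof -
  have "coz G u u = YG G u"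
    using YG_unit by (auto simp: mem_coz_iff)
  then have "openin (YG_top G u) (YG G u)"
    using openin_coz[OF u_closed] by simp
  moreover have "topspace (YG_top G u) \<subseteq> YG G u"
    unfolding YG_top_def topology_generated_by_topspace by (rule Union_least) auto
  ultimately show ?thesis
    using openin_subset by blast
qed

text \<open>The complement of the hull of \<open>A\<close> is the union of the cozero sets of the
  members of \<open>A\<close>, and \<open>coz_inf\<close>, applied to absolute values, handles
  intersections.\<close>

lemma coz_basis:
  assumes "openin (YG_top G u) U" "M \<in> U"
  shows "\<exists>f\<in>carrier G. M \<in> coz G u f \<and> coz G u f \<subseteq> U"
proof -
  have "generate_topology_on {{M \<in> YG G u. \<not> A \<subseteq> M} | A. A \<subseteq> carrier G} U"
    using assms(1) unfolding YG_top_def by (rule openin_topology_generated_by)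
  then show ?thesis
    using assms(2)
  proof (induction arbitrary: M)
    case (Int a b)
    then obtain f g where f: "f \<in> carrier G" "M \<in> coz G u f" "coz G u f \<subseteq> a"
      and g: "g \<in> carrier G" "M \<in> coz G u g" "coz G u g \<subseteq> b"
      by blast
    have "coz G u (linf G (labs G f) (labs G g)) = coz G u f \<inter> coz G u g"
      using f g by (simp add: coz_inf abs_nonneg coz_abs)
    then show ?case
      using f g by (intro bexI[of _ "linf G (labs G f) (labs G g)"]) auto
  next
    case (UN K)
    then show ?case by blast
  next
    case (Basis s)
    then obtain A where A: "A \<subseteq> carrier G" "s = {M \<in> YG G u. \<not> A \<subseteq> M}"
      by blast
    then obtain f where f: "f \<in> A" "f \<notin> M" "M \<in> YG G u"
      using Basis.prems by blast
    then have "f \<in> carrier G"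
      using A by blast
    then show ?case
      using A f by (intro bexI[of _ f]) (auto simp: mem_coz_iff)
  qed simp
qed

lemma mem_closure_coz_iff:
  "M \<in> YG_top G u closure_of coz G u g \<longleftrightarrow>
    M \<in> YG G u \<and> (\<forall>f\<in>carrier G. M \<in> coz G u f \<longrightarrow> coz G u f \<inter> coz G u g \<noteq> {})"
proof -
  have "(\<forall>T. M \<in> T \<and> openin (YG_top G u) T \<longrightarrow> (\<exists>y. y \<in> coz G u g \<and> y \<in> T)) \<longleftrightarrow>
      (\<forall>f\<in>carrier G. M \<in> coz G u f \<longrightarrow> coz G u f \<inter> coz G u g \<noteq> {})"
  proof (intro iffI allI ballI impI)
    fix T assume *: "\<forall>f\<in>carrier G. M \<in> coz G u f \<longrightarrow> coz G u f \<inter> coz G u g \<noteq> {}"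
      and "M \<in> T \<and> openin (YG_top G u) T"
    then obtain f where "f \<in> carrier G" "M \<in> coz G u f" "coz G u f \<subseteq> T"
      using coz_basis by blast
    then show "\<exists>y. y \<in> coz G u g \<and> y \<in> T"
      using * by blast
  qed (use openin_coz in blast)
  then show ?thesis
    by (simp add: in_closure_of)
qed

text \<open>Disjointness from every \<open>s\<close> disjoint from \<open>g\<close> means that no
  point of \<open>coz f\<close> has a basic neighbourhood \<open>coz s\<close> missing
  \<open>coz g\<close>.\<close>

lemma mem_bipolar_iff:
  assumes g: "g \<in> carrier G"
  shows "f \<in> bipolar G g \<longleftrightarrow> f \<in> carrier G \<and> coz G u f \<subseteq> YG_top G u closure_of coz G u g"
proof -
  have "f \<in> bipolar G g \<longleftrightarrow> f \<in> carrier G \<and>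
      (\<forall>s\<in>carrier G. coz G u s \<inter> coz G u g = {} \<longrightarrow> coz G u f \<inter> coz G u s = {})"
    using g by (auto simp: bipolar_def polar_set_def mem_polar_iff) blast
  then show ?thesis
    using coz_subset by (auto simp: subset_iff mem_closure_coz_iff)
qed

lemma mem_interior_closure_coz_iff:
  assumes g: "g \<in> carrier G"
  shows "M \<in> YG_top G u interior_of (YG_top G u closure_of coz G u g) \<longleftrightarrow>
    (\<exists>f\<in>bipolar G g. M \<in> coz G u f)"
proof
  assume "M \<in> YG_top G u interior_of (YG_top G u closure_of coz G u g)"
  then obtain T where "openin (YG_top G u) T" "M \<in> T" "T \<subseteq> YG_top G u closure_of coz G u g"
    unfolding interior_of_def by blast
  then obtain f where "f \<in> carrier G" "M \<in> coz G u f" "coz G u f \<subseteq> YG_top G u closure_of coz G u g"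
    using coz_basis[of T M] by blast
  then show "\<exists>f\<in>bipolar G g. M \<in> coz G u f"
    using g by (auto simp: mem_bipolar_iff)
next
  assume "\<exists>f\<in>bipolar G g. M \<in> coz G u f"
  then obtain f where "f \<in> carrier G" "M \<in> coz G u f"
    "coz G u f \<subseteq> YG_top G u closure_of coz G u g"
    using g by (auto simp: mem_bipolar_iff)
  then show "M \<in> YG_top G u interior_of (YG_top G u closure_of coz G u g)"
    using openin_coz unfolding interior_of_def by blast
qed

lemma mem_bipolar_self:
  assumes g: "g \<in> carrier G"
  shows "g \<in> bipolar G g"
  using g coz_subset[of g] closure_of_subset[of "coz G u g" "YG_top G u"]
  by (simp add: mem_bipolar_iff)

text \<open>The hub of the equivalences: each condition is matched with this predicate separately,
  and the theorem follows by rewriting.\<close>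

definition bipolar_coz where
  "bipolar_coz \<longleftrightarrow> (\<forall>g\<in>carrier G. \<forall>f\<in>bipolar G g. coz G u f \<subseteq> coz G u g)"

lemma bipolar_cozI:
  assumes "\<And>f g M. \<lbrakk>g \<in> carrier G; f \<in> bipolar G g; f \<in> carrier G; M \<in> YG G u; g \<in> M\<rbrakk> \<Longrightarrow> f \<in> M"
  shows bipolar_coz
  unfolding bipolar_coz_def
proof (intro ballI subsetI)
  fix g f M assume g: "g \<in> carrier G" and f: "f \<in> bipolar G g" and M: "M \<in> coz G u f"
  have "f \<in> carrier G"
    using f g by (simp add: mem_bipolar_iff)
  then show "M \<in> coz G u g"
    using assms[OF g f, of M] M g by (auto simp: mem_coz_iff)
qed

lemma bipolar_cozD:
  "bipolar_coz \<Longrightarrow> g \<in> carrier G \<Longrightarrow> f \<in> bipolar G g \<Longrightarrow> M \<in> YG G u \<Longrightarrow> g \<in> M \<Longrightarrow> f \<in> M"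
  unfolding bipolar_coz_def using mem_coz_iff[of f M] mem_coz_iff[of g M] mem_bipolar_iff[of g f]
  by blast

text \<open>The interior is the union of \<open>coz f\<close> over the bipolar of \<open>g\<close>,
  to which \<open>g\<close> itself belongs; only the inclusion into \<open>coz g\<close> has
  content.\<close>

lemma interior_closure_coz_eq_iff:
  assumes g: "g \<in> carrier G"
  shows "coz G u g = YG_top G u interior_of (YG_top G u closure_of coz G u g) \<longleftrightarrow>
    (\<forall>f\<in>bipolar G g. coz G u f \<subseteq> coz G u g)"
  using mem_interior_closure_coz_iff[OF g] mem_bipolar_self[OF g] by blast

lemma CR_iff: "CR G u \<longleftrightarrow> bipolar_coz"
  by (simp add: CR_def bipolar_coz_def interior_closure_coz_eq_iff)

lemma coz_closure_iff:
  "(\<forall>f\<in>carrier G. \<forall>g\<in>carrier G. coz G u f \<subseteq> YG_top G u closure_of coz G u g \<longrightarrow>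
      coz G u f \<subseteq> coz G u g) \<longleftrightarrow> bipolar_coz"
  unfolding bipolar_coz_def using mem_bipolar_iff by blast

text \<open>Complementation exchanges closure and interior. Applied twice, it turns regular
  closedness of \<open>Z(g)\<close> into regular openness of \<open>coz g\<close>.\<close>

lemma closure_interior_Zset:
  "YG_top G u closure_of (YG_top G u interior_of Zset G u g) =
    YG G u - YG_top G u interior_of (YG_top G u closure_of coz G u g)"
  using interior_of_complement[of "YG_top G u" "coz G u g"]
    closure_of_complement[of "YG_top G u" "YG_top G u closure_of coz G u g"]
  by (simp add: Zset_def)

lemma Zset_regular_iff:
  "(\<forall>g\<in>carrier G. Zset G u g = YG_top G u closure_of (YG_top G u interior_of Zset G u g))
    \<longleftrightarrow> bipolar_coz"
proof -
  have "Zset G u g = YG_top G u closure_of (YG_top G u interior_of Zset G u g) \<longleftrightarrow>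
      coz G u g = YG_top G u interior_of (YG_top G u closure_of coz G u g)" for g
    unfolding closure_interior_Zset
    using coz_subset[of g] interior_of_subset_topspace[of "YG_top G u" "YG_top G u closure_of coz G u g"]
    by (auto simp: Zset_def)
  then show ?thesis
    using CR_iff by (simp add: CR_def)
qed

lemma Iset_Zset: "g \<in> carrier G \<Longrightarrow> Iset G u (Zset G u g) = {f \<in> carrier G. coz G u f \<subseteq> coz G u g}"
  using coz_subset by (auto simp: Iset_def Zset_def)

text \<open>Since \<open>coz f\<close> is open, it lies in the closure of \<open>coz g\<close>
  exactly when it lies in the interior of that closure, whose complement is the closed set in
  question.\<close>

lemma Iset_closure_interior_Zset:
  assumes g: "g \<in> carrier G"
  shows "Iset G u (YG_top G u closure_of (YG_top G u interior_of Zset G u g)) = bipolar G g"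
proof -
  have "f \<in> bipolar G g \<longleftrightarrow> f \<in> carrier G \<and> coz G u f \<subseteq> YG_top G u interior_of (YG_top G u closure_of coz G u g)"
    for f
  proof
    assume "f \<in> bipolar G g"
    then have f: "f \<in> carrier G" "coz G u f \<subseteq> YG_top G u closure_of coz G u g"
      using mem_bipolar_iff[OF g] by simp_all
    show "f \<in> carrier G \<and> coz G u f \<subseteq> YG_top G u interior_of (YG_top G u closure_of coz G u g)"
      using f(1) interior_of_maximal[OF f(2) openin_coz[OF f(1)]] by (rule conjI)
  next
    assume "f \<in> carrier G \<and> coz G u f \<subseteq> YG_top G u interior_of (YG_top G u closure_of coz G u g)"
    then show "f \<in> bipolar G g"
      using g interior_of_subset[of "YG_top G u" "YG_top G u closure_of coz G u g"]
        mem_bipolar_iff[OF g] by blast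
  qed
  moreover have "YG G u - U \<subseteq> YG G u - coz G u f \<longleftrightarrow> coz G u f \<subseteq> U" for f U
    using coz_subset[of f] by blast
  ultimately show ?thesis
    unfolding closure_interior_Zset unfolding Iset_def Zset_def by (intro Set.set_eqI) (simp only: mem_Collect_eq)
qed

lemma Iset_Zset_bipolar_iff:
  "(\<forall>g\<in>carrier G. Iset G u (Zset G u g) = bipolar G g) \<longleftrightarrow> bipolar_coz"
proof -
  have "Iset G u (Zset G u g) = bipolar G g \<longleftrightarrow> (\<forall>f\<in>bipolar G g. coz G u f \<subseteq> coz G u g)"
    if g: "g \<in> carrier G" for g
    using g coz_subset closure_of_subset[of "coz G u g" "YG_top G u"]
    by (auto simp: Iset_Zset mem_bipolar_iff)
  then show ?thesis
    by (simp add: bipolar_coz_def)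
qed

lemma Iset_Zset_regular_iff:
  "(\<forall>g\<in>carrier G. Iset G u (Zset G u g) =
      Iset G u (YG_top G u closure_of (YG_top G u interior_of Zset G u g))) \<longleftrightarrow> bipolar_coz"
  using Iset_Zset_bipolar_iff by (simp add: Iset_closure_interior_Zset)

section \<open>\<open>d\<close>-ideals, kernels and units\<close>

text \<open>\<open>bipolar_coz\<close> passes from \<open>g\<close> to its bipolar at each point
  separately, so any intersection of points inherits it. One argument thus covers
  \<open>I(Z(g))\<close>, the kernels and the \<open>M_p\<close>.\<close>

lemma d_ideal_Iset:
  assumes bipolar_coz and S: "S \<subseteq> YG G u"
  shows "d_ideal G (Iset G u S)"
  unfolding d_ideal_def
proof (intro conjI ballI subsetI)
  show "lideal G (Iset G u S)"
    unfolding Iset_eq[OF S] using S YG_lideal by (intro lideal_Inter) blast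
  fix g f assume g: "g \<in> Iset G u S" and f: "f \<in> bipolar G g"
  then have "f \<in> M" if "M \<in> S" for M
    using bipolar_cozD[OF assms(1), of g f M] S that by (auto simp: Iset_eq)
  moreover have "f \<in> carrier G"
    using f by (simp add: bipolar_def polar_set_def)
  ultimately show "f \<in> Iset G u S"
    using S by (simp add: Iset_eq)
qed

lemma d_ideal_Zset_iff:
  "(\<forall>g\<in>carrier G. d_ideal G (Iset G u (Zset G u g))) \<longleftrightarrow> bipolar_coz"
proof
  assume *: "\<forall>g\<in>carrier G. d_ideal G (Iset G u (Zset G u g))"
  have "coz G u f \<subseteq> coz G u g" if "g \<in> carrier G" "f \<in> bipolar G g" for f g
  proof -
    have "g \<in> Iset G u (Zset G u g)"
      using that by (simp add: Iset_def)
    then have "f \<in> Iset G u (Zset G u g)"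
      using * that unfolding d_ideal_def by blast
    then show ?thesis
      using that by (simp add: Iset_Zset)
  qed
  then show bipolar_coz
    by (simp add: bipolar_coz_def)
qed (auto intro: d_ideal_Iset simp: Zset_def)

lemma d_ideal_Mpoint_iff: "(\<forall>p\<in>YG G u. d_ideal G (Mpoint G u p)) \<longleftrightarrow> bipolar_coz"
proof
  assume *: "\<forall>p\<in>YG G u. d_ideal G (Mpoint G u p)"
  show bipolar_coz
  proof (rule bipolar_cozI)
    fix f g M assume M: "M \<in> YG G u" and "g \<in> M" "f \<in> bipolar G g" "g \<in> carrier G" "f \<in> carrier G"
    moreover have "\<forall>x\<in>Mpoint G u M. bipolar G x \<subseteq> Mpoint G u M"
      using * M unfolding d_ideal_def by blast
    ultimately show "f \<in> M"
      by (auto simp: Mpoint_eq Iset_eq)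
  qed
qed (auto simp: Mpoint_eq intro: d_ideal_Iset)

text \<open>A point containing \<open>v\<close> would contain \<open>u\<close> by convexity. If
  there is none, a multiple of \<open>v\<close> exceeds \<open>u\<close>, and multiples of
  \<open>u\<close> exceed everything.\<close>

lemma strong_unit_iff:
  "strong_unit G v \<longleftrightarrow> v \<in> carrier G \<and> \<one> \<preceq> v \<and> (\<forall>M\<in>YG G u. v \<notin> M)"
proof -
  have "principal_lideal G v = carrier G \<longleftrightarrow> (\<forall>M\<in>YG G u. v \<notin> M)"
    if v: "v \<in> carrier G" "\<one> \<preceq> v"
  proof
    assume "principal_lideal G v = carrier G"
    then have "u \<in> principal_lideal G v" by simp
    then obtain n :: nat where n: "u \<preceq> v [^] n"
      using v u_nonneg by (auto simp: principal_lideal_def abs_of_nonneg)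
    show "\<forall>M\<in>YG G u. v \<notin> M"
    proof (intro ballI notI)
      fix M assume M: "M \<in> YG G u" "v \<in> M"
      note I = YG_lideal[OF M(1)]
      have "u \<in> M"
        using lideal_convex[OF I lideal_closed(2)[OF I] lideal_closed(7)[OF I M(2)]] n u_nonneg
        by blast
      then show False using YG_unit[OF M(1)] by simp
    qed
  next
    assume "\<forall>M\<in>YG G u. v \<notin> M"
    then obtain n :: nat where n: "u \<preceq> v [^] n"
      using no_YG_unit_le_pow v by blast
    have "f \<in> principal_lideal G v" if f: "f \<in> carrier G" for f
    proof -
      obtain k :: nat where k: "labs G f \<preceq> u [^] k"
        using u_strong f by blast
      have "u [^] k \<preceq> (v [^] n) [^] k"
        using n v by (intro pow_mono) simp_all
      then have "labs G f \<preceq> (v [^] n) [^] k"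
        using k f v le_trans[of "labs G f" "u [^] k"] by simp
      \<comment> \<open>The additional factor \<open>v\<close> makes the exponent positive, as
        \<open>principal_lideal\<close> requires; \<open>n\<close> or \<open>k\<close> may be
        0.\<close>
      then have "labs G f \<preceq> v [^] Suc (n * k)"
        using f v by (simp add: nat_pow_pow le_mult_nonneg_right)
      then show ?thesis
        using f v unfolding principal_lideal_def by (auto simp: abs_of_nonneg)
    qed
    then show "principal_lideal G v = carrier G"
      by (auto simp: principal_lideal_def)
  qed
  then show ?thesis
    by (auto simp: strong_unit_def)
qed

lemma weak_unit_strong_unit_iff:
  "(\<forall>v. weak_unit G v \<longrightarrow> strong_unit G v) \<longleftrightarrow> bipolar_coz"
proof
  assume b: bipolar_coz
  show "\<forall>v. weak_unit G v \<longrightarrow> strong_unit G v"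
  proof (intro allI impI)
    fix v assume "weak_unit G v"
    then have v: "v \<in> carrier G" "\<one> \<preceq> v" "polar G v = {\<one>}"
      by (simp_all add: weak_unit_def)
    \<comment> \<open>The polar of \<open>v\<close> is trivial, so its bipolar is all of
      \<open>G\<close> and contains \<open>u\<close>. A point containing \<open>v\<close> would then
      contain \<open>u\<close>.\<close>
    have "coz G u \<one> = {}"
      using lideal_closed(2)[OF YG_lideal] by (auto simp: mem_coz_iff)
    then have "u \<in> bipolar G v"
      using v by (simp add: bipolar_def polar_set_def mem_polar_iff)
    then show "strong_unit G v"
      using v bipolar_cozD[OF b v(1)] YG_unit[of _ u] by (auto simp: strong_unit_iff)
  qed
next
  assume *: "\<forall>v. weak_unit G v \<longrightarrow> strong_unit G v"
  show bipolar_coz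
  proof (rule bipolar_cozI, rule ccontr)
    fix f g M assume M: "M \<in> YG G u" and gM: "g \<in> M" and fM: "f \<notin> M"
      and f: "f \<in> carrier G" "f \<in> bipolar G g" and g: "g \<in> carrier G"
    note I = YG_lideal[OF M]
    define a where "a = labs G f"
    have a: "a \<in> carrier G" "\<one> \<preceq> a" "a \<notin> M"
      using f fM by (simp_all add: a_def abs_nonneg lideal_abs_iff[OF I])
    then obtain m n where m: "m \<in> M" "\<one> \<preceq> m" "u \<preceq> m \<otimes> a [^] (n::nat)"
      using YG_cofinal[OF M] by blast
    have mc: "m \<in> carrier G" using m lideal_closed(1)[OF I] by blast
    text \<open>What is disjoint from \<open>g\<close> is disjoint from \<open>f\<close>; if it is also disjoint from \<open>m\<close>, it is
      disjoint from \<open>u \<le> m + n|f|\<close>. So \<open>|g| + m\<close> is a weak unit in \<open>M\<close>.\<close>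
    define v where "v = labs G g \<otimes> m"
    have v: "v \<in> carrier G" "\<one> \<preceq> v" "v \<in> M"
      using g gM m mc
      by (simp_all add: v_def mult_nonneg abs_nonneg lideal_closed[OF I] lideal_abs_iff[OF I])
    have "h = \<one>" if h: "h \<in> polar G v" for h
    proof -
      define b where "b = labs G h"
      have hc: "h \<in> carrier G" and "linf G b v = \<one>"
        using h v by (simp_all add: polar_def b_def abs_of_nonneg)
      then have b: "b \<in> carrier G" "\<one> \<preceq> b" "linf G v b = \<one>"
        using v inf_commute[of v b] by (simp_all add: b_def abs_nonneg)
      have "labs G g \<preceq> v" "m \<preceq> v"
        using g m mc by (simp_all add: v_def le_mult_nonneg_right le_mult_nonneg_left abs_nonneg)
      then have 1: "linf G (labs G g) b = \<one>" and 2: "linf G m b = \<one>"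
        using b m mc g by (simp_all add: inf_eq_one_mono[OF b(3)] v(1) abs_nonneg)
      have "h \<in> polar G g"
        using 1 hc g inf_commute[of "labs G h" "labs G g"] by (simp add: polar_def b_def)
      then have "linf G b a = \<one>"
        using f hc inf_commute[of b a]
        by (simp add: bipolar_def polar_set_def polar_iff a_def b_def)
      then have "linf G b (m \<otimes> a [^] n) = \<one>"
        using inf_pow_eq_one[of b a n] inf_mult_eq_one[of b m "a [^] n"] 2 a b m mc
          inf_commute[of b m] by (simp add: pow_nonneg)
      then have "linf G (m \<otimes> a [^] n) b = \<one>"
        using a b mc by (subst inf_commute) simp_all
      then have "linf G u b = \<one>"
        using u_nonneg m(3) by (rule inf_eq_one_mono) (use a b mc in simp_all)
      then have "linf G b u = \<one>"
        using b by (subst inf_commute) simp_all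
      then have "b = \<one>"
        by (rule disjoint_unit[rotated 2]) (use b in simp_all)
      then show ?thesis
        using hc by (simp add: b_def abs_eq_one)
    qed
    moreover have "\<one> \<in> polar G v"
      using v lideal_closed(2)[OF YG_lideal] by (auto simp: mem_polar_iff mem_coz_iff)
    ultimately have "polar G v = {\<one>}"
      by blast
    then have "weak_unit G v"
      using v by (simp add: weak_unit_def)
    then show False
      using * M v by (auto simp: strong_unit_iff)
  qed
qed

end

section \<open>Kernels as intersections of maximal ideals\<close>

lemma Wstar_imp_wstar:
  assumes "Wstar G u"
  shows "wstar G u"
proof -
  have "ab_lgroup G"
    using assms unfolding Wstar_def abelian_lgroup_def
    by (intro ab_lgroup.intro ab_lgroup_axioms.intro) blast+
  then show ?thesis
    using assms by (intro wstar.intro wstar_axioms.intro)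
qed

text \<open>The maximal ideals \<open>N\<close> of the target meet trivially, so \<open>h x\<close>
  vanishes exactly when \<open>x\<close> lies in every preimage \<open>P N\<close>. The work is to
  see that these preimages are points of \<open>YG G u\<close>.\<close>

lemma kernel_eq_Iset:
  fixes G :: "'a lgroup" and H :: "'b lgroup"
  assumes "Wstar G u" "Wstar H v" "Wstar_morphism G u H v h"
  obtains S where "S \<subseteq> YG G u" "kernel G H h = Iset G u S"
proof -
  interpret G: wstar G u by (rule Wstar_imp_wstar) fact
  interpret H: wstar H v by (rule Wstar_imp_wstar) fact
  have hom: "h \<in> hom G H" and hu: "h u = v"
    and hsup: "\<And>x y. x \<in> carrier G \<Longrightarrow> y \<in> carrier G \<Longrightarrow> h (lsup G x y) = lsup H (h x) (h y)"
    and hinf: "\<And>x y. x \<in> carrier G \<Longrightarrow> y \<in> carrier G \<Longrightarrow> h (linf G x y) = linf H (h x) (h y)"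
    using assms(3) by (auto simp: Wstar_morphism_def lgroup_hom_def)
  interpret gh: group_hom G H h
    by unfold_locales (fact hom)
  have hmono: "lle H (h x) (h y)" if "x \<in> carrier G" "y \<in> carrier G" "lle G x y" for x y
  proof -
    have "lsup G x y = y"
      using that by (intro G.le_antisym G.sup_least G.sup_ge2) simp_all
    then show ?thesis
      using hsup[of x y] H.sup_ge1[of "h x" "h y"] that by simp
  qed
  define P where "P N = {x \<in> carrier G. h x \<in> N}" for N
  have PY: "P N \<in> YG G u" if N: "N \<in> YG H v" for N
  proof (rule G.YG_I)
    note I = H.YG_lideal[OF N]
    note Ic = H.lideal_closed[OF I]
    show "lideal G (P N)"
      unfolding lideal_def
    proof (intro conjI ballI impI)
      show "subgroup (P N) G"
        by (rule G.subgroupI) (use Ic in \<open>auto simp: P_def intro: exI[of _ "\<one>\<^bsub>G\<^esub>"]\<close>)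
      fix x y assume xy: "x \<in> P N" "y \<in> P N"
      then show "lsup G x y \<in> P N" "linf G x y \<in> P N"
        using Ic by (simp_all add: P_def hsup hinf)
      fix z assume "z \<in> carrier G" "lle G x z \<and> lle G z y"
      then show "z \<in> P N"
        using xy hmono H.lideal_convex[OF I, of "h x" "h y" "h z"] by (simp add: P_def)
    qed
    show "u \<notin> P N"
      using H.YG_unit[OF N] hu by (simp add: P_def)
    show "\<exists>m\<in>P N. \<exists>n::nat. lle G u (m \<otimes>\<^bsub>G\<^esub> a [^]\<^bsub>G\<^esub> n)"
      if a: "a \<in> carrier G" "lle G \<one>\<^bsub>G\<^esub> a" "a \<notin> P N" for a
    proof -
      have ha: "lle H \<one>\<^bsub>H\<^esub> (h a)" "h a \<notin> N"
        using a hmono[of "\<one>\<^bsub>G\<^esub>" a] by (simp_all add: P_def)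
      then obtain k n where k: "k \<in> N" "lle H \<one>\<^bsub>H\<^esub> k" "lle H v (k \<otimes>\<^bsub>H\<^esub> h a [^]\<^bsub>H\<^esub> (n::nat))"
        using H.YG_cofinal[OF N, of "h a"] a by auto
      have kc: "k \<in> carrier H" using k Ic(1) by blast
      \<comment> \<open>\<open>k\<close> need not be in the image of \<open>h\<close>. The positive
        part of \<open>d\<close>, additively \<open>u - n a\<close>, replaces it: its image lies
        between \<open>\<one>\<close> and \<open>k\<close>, hence in \<open>N\<close>.\<close>
      define d where "d = u \<otimes>\<^bsub>G\<^esub> inv\<^bsub>G\<^esub> (a [^]\<^bsub>G\<^esub> n)"
      have vc: "v \<in> carrier H"
        using H.u_closed .
      have d: "d \<in> carrier G" "h d = v \<otimes>\<^bsub>H\<^esub> inv\<^bsub>H\<^esub> (h a [^]\<^bsub>H\<^esub> n)"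
        using a hu by (simp_all add: d_def gh.hom_nat_pow)
      have "lle H (h d) k"
        using k kc a d vc H.le_mult_iff[of v k "h a [^]\<^bsub>H\<^esub> n"] by simp
      then have "lle H (lsup H (h d) \<one>\<^bsub>H\<^esub>) k"
        using k kc a d vc by (intro H.sup_least) simp_all
      then have "lsup H (h d) \<one>\<^bsub>H\<^esub> \<in> N"
        using H.lideal_convex[OF I Ic(2) k(1), of "lsup H (h d) \<one>\<^bsub>H\<^esub>"]
          H.ppart_nonneg[of "h d"] H.sup_closed[of "h d" "\<one>\<^bsub>H\<^esub>"] gh.hom_closed[OF d(1)]
        by blast
      then have "lsup G d \<one>\<^bsub>G\<^esub> \<in> P N"
        using d by (simp add: P_def hsup)
      moreover have "lle G u (lsup G d \<one>\<^bsub>G\<^esub> \<otimes>\<^bsub>G\<^esub> a [^]\<^bsub>G\<^esub> n)"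
        using a d G.le_ppart[OF d(1)] G.le_mult_iff[of u "lsup G d \<one>\<^bsub>G\<^esub>" "a [^]\<^bsub>G\<^esub> n"]
        by (simp add: d_def)
      ultimately show ?thesis by blast
    qed
  qed (simp_all add: G.u_nonneg)
  have "kernel G H h = Iset G u (P ` YG H v)"
  proof -
    have "h x = \<one>\<^bsub>H\<^esub> \<longleftrightarrow> (\<forall>N\<in>YG H v. h x \<in> N)" if "x \<in> carrier G" for x
      using H.YG_separates[of "h x"] H.lideal_closed(2)[OF H.YG_lideal] that by auto
    then show ?thesis
      using PY by (auto simp: G.Iset_eq image_subset_iff kernel_def P_def)
  qed
  then show thesis
    using that PY by blast
qed

text \<open>Each point is itself a kernel, namely of evaluation there, and each kernel is an
  \<open>Iset\<close>; so the kernels lie between the cases already settled.\<close>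

lemma (in wstar) d_ideal_kernel_iff:
  "(\<forall>K. Wstar_kernel G u K \<longrightarrow> d_ideal G K) \<longleftrightarrow> bipolar_coz"
proof
  assume *: "\<forall>K. Wstar_kernel G u K \<longrightarrow> d_ideal G K"
  have "d_ideal G (Mpoint G u p)" if p: "p \<in> YG G u" for p
  proof -
    have "Mpoint G u p = p"
      using p lideal_closed(1)[OF YG_lideal[OF p]] by (auto simp: Mpoint_eq Iset_eq)
    then show ?thesis
      using * max_lideal.Wstar_kernel_max_lideal[OF max_lideal[OF p] W] by simp
  qed
  then show bipolar_coz
    using d_ideal_Mpoint_iff by blast
next
  assume b: bipolar_coz
  show "\<forall>K. Wstar_kernel G u K \<longrightarrow> d_ideal G K"
  proof (intro allI impI)
    fix K assume "Wstar_kernel G u K"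
    then obtain H :: "'a set lgroup" and v h where
      "Wstar H v" "Wstar_morphism G u H v h" "K = kernel G H h"
      unfolding Wstar_kernel_def by blast
    then obtain S where "S \<subseteq> YG G u" "K = Iset G u S"
      using kernel_eq_Iset[OF W] by metis
    then show "d_ideal G K"
      using d_ideal_Iset[OF b] by simp
  qed
qed

theorem theorem3p3:
  fixes G :: "'a lgroup" and u :: 'a
  assumes "Wstar G u"
  shows
    "(CR G u \<longleftrightarrow>
       (\<forall>f\<in>carrier G. \<forall>g\<in>carrier G.
          coz G u f \<subseteq> YG_top G u closure_of coz G u g \<longrightarrow> coz G u f \<subseteq> coz G u g)) \<and>
     (CR G u \<longleftrightarrow>
       (\<forall>g\<in>carrier G. Iset G u (Zset G u g) =
          Iset G u (YG_top G u closure_of (YG_top G u interior_of Zset G u g)))) \<and>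
     (CR G u \<longleftrightarrow>
       (\<forall>g\<in>carrier G. Zset G u g =
          YG_top G u closure_of (YG_top G u interior_of Zset G u g))) \<and>
     (CR G u \<longleftrightarrow> (\<forall>g\<in>carrier G. Iset G u (Zset G u g) = bipolar G g)) \<and>
     ((\<forall>g\<in>carrier G. d_ideal G (Iset G u (Zset G u g))) \<longleftrightarrow>
       (\<forall>K. Wstar_kernel G u K \<longrightarrow> d_ideal G K)) \<and>
     ((\<forall>g\<in>carrier G. d_ideal G (Iset G u (Zset G u g))) \<longleftrightarrow>
       (\<forall>p\<in>YG G u. d_ideal G (Mpoint G u p))) \<and>
     (CR G u \<longleftrightarrow> (\<forall>g\<in>carrier G. d_ideal G (Iset G u (Zset G u g)))) \<and>
     ((\<forall>g\<in>carrier G. d_ideal G (Iset G u (Zset G u g))) \<longleftrightarrow>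
       (\<forall>v. weak_unit G v \<longrightarrow> strong_unit G v))"
proof -
  interpret wstar G u
    by (rule Wstar_imp_wstar) fact
  show ?thesis
    unfolding CR_iff coz_closure_iff Iset_Zset_regular_iff Zset_regular_iff Iset_Zset_bipolar_iff
      d_ideal_Zset_iff d_ideal_kernel_iff d_ideal_Mpoint_iff weak_unit_strong_unit_iff
    by simp
qed

end
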